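(* There exist a separable Fréchet space $X$ and a continuous linear operator $T$ on $X$ such that $T$ is frequently hypercyclic and, for every $0<r\le1$, $T$ is not $A_r$-frequently hypercyclic; hence $T$ does not satisfy the Frequent Hypercyclicity Criterion.
   Context: $\mathbb{N}$ is the set of positive integers. For a non-negative sequence $(\alpha_k)_{k\ge1}$ with $\sum_{k}\alpha_k=+\infty$, the associated admissible matrix is $A=(\alpha_k/\sum_{j=1}^n\alpha_j)$, i.e. the infinite matrix $(\alpha_{n,k})$ with $\alpha_{n,k}=\alpha_k/\sum_{j=1}^n\alpha_j$ for $1\le k\le n$ and $\alpha_{n,k}=0$ for $k>n$. The lower $A$-density of $E\subset\mathbb{N}$ is $$\underline{d}_A(E)=\liminf_{n\to+\infty}\frac{\sum_{k\le n,\,k\in E}\alpha_k}{\sum_{j=1}^n\alpha_j}.$$ For $r\ge0$, $A_r$ is the admissible matrix associated with $\alpha_k=e^{k^r}$, $k\ge1$. The natural lower density $\underline{d}$ corresponds to $\alpha_k=1$ for all $k$. A continuous linear operator $T$ on $X$ is $A$-frequently hypercyclic (resp. frequently hypercyclic) if there is $x\in X$ such that for every non-empty open set $U\subset X$, the set $N(x,U)=\{n\in\mathbb{N}:T^nx\in U\}$ satisfies $\underline{d}_A(N(x,U))>0$ (resp. $\underline{d}(N(x,U))>0$). $T$ satisfies the Frequent Hypercyclicity Criterion if there are a dense subset $X_0$ of $X$ and a map $S:X_0\to X_0$ such that, for every $x\in X_0$: (i) $\sum_{n=0}^{+\infty}T^nx$ converges unconditionally; (ii) $\sum_{n=0}^{+\infty}S^nx$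 converges unconditionally; (iii) $TSx=x$. *)

theory Defs
  imports "HOL-Analysis.Analysis" "HOL-Library.Function_Algebras"
begin

section \<open>Frechet spaces\<close>

text \<open>
  The underlying vector space is \<open>topspace X\<close>, a linear subspace of the ambient type \<open>'v\<close>.
  A Frechet space is a locally convex topological vector space whose topology is induced by a
  complete translation-invariant metric (this includes the Hausdorff property).
\<close>

locale frechet_space = vector_space scl
  for scl :: "'k::real_normed_field \<Rightarrow> 'v::ab_group_add \<Rightarrow> 'v" (infixr \<open>*s\<close> 75) +
  fixes X :: "'v topology"
  assumes subspace_topspace: "subspace (topspace X)"
    and continuous_add: "continuous_map (prod_topology X X) X (\<lambda>(x, y). x + y)"
    and continuous_scale: "continuous_map (prod_topology euclidean X) X (\<lambda>(c, x). c *s x)"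
    and locally_convex:
      "\<And>U. openin X U \<Longrightarrow> 0 \<in> U \<Longrightarrow>
        \<exists>V. openin X V \<and> 0 \<in> V \<and> V \<subseteq> U \<and>
          (\<forall>x\<in>V. \<forall>y\<in>V. \<forall>t\<in>{0..1::real}. of_real (1 - t) *s x + of_real t *s y \<in> V)"
    and complete_invariant_metric:
      "\<exists>d. Metric_space (topspace X) d \<and>
        (\<forall>x\<in>topspace X. \<forall>y\<in>topspace X. \<forall>z\<in>topspace X. d (x + z) (y + z) = d x y) \<and>
        Metric_space.mcomplete (topspace X) d \<and>
        Metric_space.mtopology (topspace X) d = X"

text \<open>Only the restriction of \<open>T\<close> to \<open>topspace X\<close> matters.\<close>

definition continuous_linear_operator ::
    "('k::real_normed_field \<Rightarrow> 'v::ab_group_add \<Rightarrow> 'v) \<Rightarrow> 'v topology \<Rightarrow> ('v \<Rightarrow> 'v) \<Rightarrow> bool" where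
  "continuous_linear_operator scl X T \<longleftrightarrow>
     continuous_map X X T \<and>
     (\<forall>x\<in>topspace X. \<forall>y\<in>topspace X. T (x + y) = T x + T y) \<and>
     (\<forall>c. \<forall>x\<in>topspace X. T (scl c x) = scl c (T x))"

section \<open>Weighted lower densities and frequent hypercyclicity\<close>

text \<open>
  An admissible matrix is represented by its weight sequence \<open>\<alpha>\<close>, indexed from 1; the value
  \<open>\<alpha> 0\<close> is irrelevant.
\<close>

definition lower_density :: "(nat \<Rightarrow> real) \<Rightarrow> nat set \<Rightarrow> ereal" where
  "lower_density \<alpha> E = liminf (\<lambda>n. ereal ((\<Sum>k\<in>{1..n} \<inter> E. \<alpha> k) / (\<Sum>j=1..n. \<alpha> j)))"

definition exp_weight :: "real \<Rightarrow> nat \<Rightarrow> real" where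
  "exp_weight r k = exp (real k powr r)"

definition return_times :: "('v \<Rightarrow> 'v) \<Rightarrow> 'v \<Rightarrow> 'v set \<Rightarrow> nat set" where
  "return_times T x U = {n. 1 \<le> n \<and> (T ^^ n) x \<in> U}"

definition weighted_frequently_hypercyclic ::
    "(nat \<Rightarrow> real) \<Rightarrow> 'v topology \<Rightarrow> ('v \<Rightarrow> 'v) \<Rightarrow> bool" where
  "weighted_frequently_hypercyclic \<alpha> X T \<longleftrightarrow>
     (\<exists>x\<in>topspace X. \<forall>U. openin X U \<and> U \<noteq> {} \<longrightarrow> lower_density \<alpha> (return_times T x U) > 0)"

definition frequently_hypercyclic :: "'v topology \<Rightarrow> ('v \<Rightarrow> 'v) \<Rightarrow> bool" where
  "frequently_hypercyclic = weighted_frequently_hypercyclic (\<lambda>k. 1)"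

section \<open>The Frequent Hypercyclicity Criterion\<close>

definition converges_unconditionally ::
    "'v::ab_group_add topology \<Rightarrow> (nat \<Rightarrow> 'v) \<Rightarrow> bool" where
  "converges_unconditionally X u \<longleftrightarrow>
     (\<forall>\<pi>::nat \<Rightarrow> nat. bij \<pi> \<longrightarrow> (\<exists>l. limitin X (\<lambda>N. \<Sum>n<N. u (\<pi> n)) l sequentially))"

definition frequent_hypercyclicity_criterion ::
    "'v::ab_group_add topology \<Rightarrow> ('v \<Rightarrow> 'v) \<Rightarrow> bool" where
  "frequent_hypercyclicity_criterion X T \<longleftrightarrow>
     (\<exists>X\<^sub>0 S. X\<^sub>0 \<subseteq> topspace X \<and> X closure_of X\<^sub>0 = topspace X \<and> S ` X\<^sub>0 \<subseteq> X\<^sub>0 \<and>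
        (\<forall>x\<in>X\<^sub>0. converges_unconditionally X (\<lambda>n. (T ^^ n) x) \<and>
                 converges_unconditionally X (\<lambda>n. (S ^^ n) x) \<and>
                 T (S x) = x))"

section \<open>The ambient space of the existence statement\<close>

text \<open>
  HOL cannot quantify existentially over types, so Frechet spaces are sought among the linear
  subspaces of the space of all scalar sequences, with an arbitrary topology unrelated to the
  product topology.  Up to isomorphism this is no restriction: a separable Frechet space has at
  most the cardinality, hence at most the algebraic dimension, of the continuum, and the space of
  scalar sequences has algebraic dimension exactly the continuum.
\<close>

definition seq_scale :: "'k::real_normed_field \<Rightarrow> (nat \<Rightarrow> 'k) \<Rightarrow> nat \<Rightarrow> 'k" where
  "seq_scale c x = (\<lambda>n. c * x n)"

end

theory Submission
  imports Defs "HOL-Computational_Algebra.Factorial_Ring" "HOL-Real_Asymp.Real_Asymp"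
begin

text \<open>
  The space is \<open>c0_space v\<close>, the scalar sequences \<open>x\<close> with \<open>v n * norm (x n) \<rightarrow> 0\<close>, for a weight
  \<open>v n = (1 / 2) ^ height n\<close>, and the operator is the unweighted backward shift, which is continuous
  because \<open>height\<close> increases by at most 1 at each step. This is a weighted backward shift on the
  usual space of null sequences, written in coordinates that put all the weights into the norm.

  The function \<open>height\<close> is at least \<open>2 * p\<close> in two kinds of places: on the first \<open>p\<close> integers from each
  positive multiple of \<open>16 ^ p\<close>, inside the set \<open>collar p\<close>, and on a long interval around \<open>16 ^ p\<close>,
  inside \<open>scale_band p\<close>. Outside all collars and bands of index at least \<open>p \<ge> 1\<close> it is less than
  \<open>2 * p\<close>; no band meets the open interval between \<open>3 * 16 ^ k\<close> and \<open>8 * 16 ^ k\<close>, and the collars of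
  large index are sparse there.

  \<^item> Frequent hypercyclicity. Let \<open>z p\<close> run through a dense set of finite sequences, each
  occurring for arbitrarily large \<open>p\<close>, with \<open>z p\<close> supported in \<open>{0..<p}\<close>. The vector \<open>x\<close> carries
  a copy of \<open>z p\<close> at every position of \<open>hitting_times p\<close>, the multiples of \<open>16 ^ p\<close> in the
  intervals \<open>[16 ^ u, 2 * 16 ^ u)\<close> with \<open>u\<close> of 2-adic valuation \<open>p\<close>. These sets have positive lower
  density. The difference of two hitting times in the same interval is a multiple of \<open>16 ^ p\<close>, and
  the difference of two from different intervals has the order of magnitude of the larger one; in
  both cases the height there is large (\<open>hitting_times_separated\<close>), so after \<open>m\<close> shifts, where
  \<open>m \<in> hitting_times p\<close>, the other copies contribute little to the norm and what remains is
  \<open>z p\<close> (\<open>concatenation_approximates\<close>).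

  \<^item> Failure for the weights \<open>exp (k powr r)\<close>. If \<open>n\<close> is a time at which the orbit of some \<open>x\<close>
  visits the ball of radius 1 around \<open>(2, 0, 0, ...)\<close> then \<open>norm (x n) \<ge> 1\<close>, so \<open>v n * norm (x n) \<rightarrow> 0\<close> forces the
  height to tend to infinity along these times. Take \<open>n = landmark (k + 1)\<close>, which lies between
  \<open>6 * 16 ^ k\<close> and \<open>7 * 16 ^ k\<close>. For large \<open>k\<close> the return times up to \<open>n\<close> lie in \<open>{1..3 * 16 ^ k}\<close>, whose
  weight is negligible since the weights grow faster than any power, or in collars of large
  index. As the weights increase, translating a collar to the right shows that \<open>collar q\<close> carries at most
  the proportion \<open>1 / 2 ^ q\<close> of the total weight (\<open>collar_weight_le\<close>). So the weighted lower density
  of the return times is 0.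

  \<^item> Failure of the criterion. If \<open>S\<close> is a right inverse as in the criterion, coordinate \<open>n\<close> of
  \<open>(S ^^ n) x\<close> is \<open>x 0\<close>. The terms \<open>(S ^^ n) x\<close> of a convergent series tend to 0, hence \<open>v\<close> tends to 0;
  but \<open>height (landmark k) = 0\<close> for every \<open>k\<close>.
\<close>

section \<open>Weighted spaces of null sequences\<close>

text \<open>The sequences that tend to 0 after multiplication by \<open>v\<close>.\<close>

definition c0_space :: "(nat \<Rightarrow> real) \<Rightarrow> (nat \<Rightarrow> 'k::{real_normed_field, euclidean_space}) set" where
  "c0_space v = {x. (\<lambda>n. v n * norm (x n)) \<longlonglongrightarrow> 0}"

text \<open>The weighted supremum distance, truncated at 1. The truncation makes it a bounded function of all
  pairs of sequences, so that the supremum is a genuine one even outside \<open>c0_space v\<close>; for distances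
  below 1 it agrees with the weighted supremum norm of \<open>x - y\<close>.\<close>

definition c0_dist ::
    "(nat \<Rightarrow> real) \<Rightarrow> (nat \<Rightarrow> 'k::{real_normed_field, euclidean_space}) \<Rightarrow> (nat \<Rightarrow> 'k) \<Rightarrow> real" where
  "c0_dist v x y = (SUP n. min 1 (v n * norm (x n - y n)))"

definition c0_topology ::
    "(nat \<Rightarrow> real) \<Rightarrow> (nat \<Rightarrow> 'k::{real_normed_field, euclidean_space}) topology" where
  "c0_topology v = Metric_space.mtopology (c0_space v) (c0_dist v)"

text \<open>The finitely supported sequence with entries \<open>e i\<close>, where \<open>i\<close> runs through the list. With \<open>e\<close> enumerating
  a dense set of scalars these form a countable dense set, indexed by \<open>nat list\<close>.\<close>

definition finite_sequence ::
    "(nat \<Rightarrow> 'k::{real_normed_field, euclidean_space}) \<Rightarrow> nat list \<Rightarrow> nat \<Rightarrow> 'k" where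
  "finite_sequence e xs = (\<lambda>i. if i < length xs then e (xs ! i) else 0)"

definition backward_shift :: "(nat \<Rightarrow> 'a) \<Rightarrow> nat \<Rightarrow> 'a" where
  "backward_shift x = (\<lambda>n. x (Suc n))"

lemma backward_shift_funpow: "(backward_shift ^^ m) x n = x (n + m)"
  by (induction m arbitrary: n) (simp_all add: backward_shift_def)

lemma obtain_dense_sequence:
  obtains e :: "nat \<Rightarrow> 'a::euclidean_space" where "\<And>y \<epsilon>. 0 < \<epsilon> \<Longrightarrow> \<exists>i. dist (e i) y < \<epsilon>"
proof -
  obtain D :: "'a set" where D: "countable D" "\<And>X. open X \<Longrightarrow> X \<noteq> {} \<Longrightarrow> \<exists>d\<in>D. d \<in> X"
    using countable_dense_exists by blast
  have "D \<noteq> {}" using D(2)[of UNIV] by auto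
  show thesis
  proof
    fix y :: 'a and \<epsilon> :: real assume "0 < \<epsilon>"
    then obtain d where "d \<in> D" "d \<in> ball y \<epsilon>" using D(2)[of "ball y \<epsilon>"] by auto
    then show "\<exists>i. dist (from_nat_into D i) y < \<epsilon>"
      using from_nat_into_surj[OF D(1)] by (metis dist_commute mem_ball)
  qed
qed

text \<open>Positive weights for which the backward shift is bounded by 2 on the weighted space.\<close>

locale c0_weight =
  fixes v :: "nat \<Rightarrow> real"
  assumes weight_pos: "0 < v n"
    and weight_step: "v n \<le> 2 * v (Suc n)"
begin

lemma c0_dist_upper: "min 1 (v n * norm (x n - y n)) \<le> c0_dist v x y"
  unfolding c0_dist_def by (rule cSUP_upper) (auto intro!: bdd_aboveI[of _ 1])

lemma c0_dist_le: "(\<And>n. v n * norm (x n - y n) \<le> e) \<Longrightarrow> c0_dist v x y \<le> e"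
  unfolding c0_dist_def by (rule cSUP_least) (auto intro: min.coboundedI2)

lemma c0_dist_less_imp:
  assumes "c0_dist v x y < e" "e \<le> 1" shows "v n * norm (x n - y n) < e"
  using c0_dist_upper[of n x y] assms by (auto simp: min_def split: if_splits)

lemma c0_dist_nonneg: "0 \<le> c0_dist v x y"
  using c0_dist_upper[of 0 x y] weight_pos[of 0]
  by (smt (verit) mult_nonneg_nonneg norm_ge_zero)

lemma c0_dist_triangle: "c0_dist v x z \<le> c0_dist v x y + c0_dist v y z"
  unfolding c0_dist_def[of v x z]
proof (rule cSUP_least)
  fix n
  have "norm (x n - z n) \<le> norm (x n - y n) + norm (y n - z n)"
    using norm_triangle_ineq[of "x n - y n" "y n - z n"] by simp
  then have "v n * norm (x n - z n) \<le> v n * norm (x n - y n) + v n * norm (y n - z n)"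
    using weight_pos[of n] by (simp flip: distrib_left)
  moreover have "0 \<le> v n * norm (x n - y n)" "0 \<le> v n * norm (y n - z n)"
    using weight_pos[of n] by simp_all
  ultimately show "min 1 (v n * norm (x n - z n)) \<le> c0_dist v x y + c0_dist v y z"
    using c0_dist_upper[of n x y] c0_dist_upper[of n y z] by linarith
qed auto

lemma c0_dist_eq_0_iff: "c0_dist v x y = 0 \<longleftrightarrow> x = y"
proof
  assume 0: "c0_dist v x y = 0"
  have "x n = y n" for n
  proof -
    have "v n * norm (x n - y n) \<le> 0"
      using c0_dist_upper[of n x y] 0 by (auto simp: min_def split: if_splits)
    then show ?thesis using weight_pos[of n] by (simp add: mult_le_0_iff)
  qed
  then show "x = y" by blast
next
  assume "x = y" then show "c0_dist v x y = 0" by (simp add: c0_dist_def)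
qed

lemma Metric_space_c0: "Metric_space (c0_space v) (c0_dist v)"
proof
  show "c0_dist v x y = c0_dist v y x" for x y by (simp add: c0_dist_def norm_minus_commute)
qed (auto simp: c0_dist_nonneg c0_dist_eq_0_iff intro: c0_dist_triangle)

sublocale c0: Metric_space "c0_space v" "c0_dist v"
  by (rule Metric_space_c0)

lemma c0_topology: "c0.mtopology = c0_topology v"
  by (simp add: c0_topology_def)

lemma topspace_c0 [simp]: "topspace (c0_topology v) = c0_space v"
  by (simp flip: c0_topology)

lemma openin_c0_mball [iff]: "openin (c0_topology v) (c0.mball x r)"
  by (simp flip: c0_topology)

lemma c0_spaceD: "x \<in> c0_space v \<Longrightarrow> 0 < \<epsilon> \<Longrightarrow> \<exists>N. \<forall>n\<ge>N. v n * norm (x n) < \<epsilon>"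
  using weight_pos unfolding c0_space_def LIMSEQ_def by (simp add: abs_mult less_imp_le)

lemma c0_spaceI:
  assumes "\<And>\<epsilon>. 0 < \<epsilon> \<Longrightarrow> \<exists>N. \<forall>n\<ge>N. v n * norm (x n) < \<epsilon>" shows "x \<in> c0_space v"
  using assms weight_pos unfolding c0_space_def LIMSEQ_def by (simp add: abs_mult less_imp_le)

lemma c0_space_bounded:
  assumes "x \<in> c0_space v" obtains B where "0 < B" "\<And>n. v n * norm (x n) \<le> B"
proof -
  have "Bseq (\<lambda>n. v n * norm (x n))"
    using assms by (auto simp: c0_space_def intro: convergent_imp_Bseq convergentI)
  then obtain B where "0 < B" "\<And>n. norm (v n * norm (x n)) \<le> B" by (auto elim: BseqE)
  then show thesis by (metis abs_ge_self order_trans real_norm_def that)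
qed

lemma zero_in_c0: "0 \<in> c0_space v"
  by (simp add: c0_space_def)

lemma add_in_c0:
  assumes "x \<in> c0_space v" "y \<in> c0_space v" shows "x + y \<in> c0_space v"
proof -
  have lim: "(\<lambda>n. v n * norm (x n) + v n * norm (y n)) \<longlonglongrightarrow> 0"
    using assms tendsto_add[of "\<lambda>n. v n * norm (x n)" 0] by (simp add: c0_space_def)
  have "norm (v n * norm ((x + y) n)) \<le> v n * norm (x n) + v n * norm (y n)" for n
    using weight_pos[of n] mult_left_mono[OF norm_triangle_ineq[of "x n" "y n"], of "v n"]
    by (simp add: abs_mult distrib_left)
  from Lim_null_comparison[OF always_eventually[OF allI[OF this]] lim]
  show ?thesis by (simp add: c0_space_def)
qed

lemma scale_in_c0: "x \<in> c0_space v \<Longrightarrow> seq_scale c x \<in> c0_space v"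
  using tendsto_mult_right_zero[of "\<lambda>n. v n * norm (x n)" sequentially "norm c"]
  by (simp add: c0_space_def seq_scale_def norm_mult mult.left_commute)

lemma shift_in_c0:
  assumes "x \<in> c0_space v" shows "backward_shift x \<in> c0_space v"
proof -
  have lim: "(\<lambda>n. 2 * (v (Suc n) * norm (x (Suc n)))) \<longlonglongrightarrow> 0"
    using assms LIMSEQ_Suc[of "\<lambda>n. v n * norm (x n)" 0] tendsto_mult_right_zero
    unfolding c0_space_def by blast
  have "norm (v n * norm (x (Suc n))) \<le> 2 * (v (Suc n) * norm (x (Suc n)))" for n
    using weight_pos[of n] mult_right_mono[OF weight_step[of n], of "norm (x (Suc n))"]
    by (simp add: abs_mult)
  from Lim_null_comparison[OF always_eventually[OF allI[OF this]] lim]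
  show ?thesis by (simp add: c0_space_def backward_shift_def)
qed

lemma finite_support_in_c0:
  assumes "\<And>n. N \<le> n \<Longrightarrow> x n = 0" shows "x \<in> c0_space v"
  using assms by (intro c0_spaceI exI[of _ N]) auto

lemma c0_dist_translate: "c0_dist v (x + z) (y + z) = c0_dist v x y"
  by (simp add: c0_dist_def)

lemma c0_mcomplete:
  "Metric_space.mcomplete
    (c0_space v :: (nat \<Rightarrow> 'k::{real_normed_field, euclidean_space}) set) (c0_dist v)"
  unfolding c0.mcomplete_def
proof (intro allI impI)
  fix \<sigma> :: "nat \<Rightarrow> nat \<Rightarrow> 'k"
  assume C: "c0.MCauchy \<sigma>"
  then have mem: "\<sigma> k \<in> c0_space v" for k by (auto simp: c0.MCauchy_def)
  have cau: "\<exists>N. \<forall>k\<ge>N. \<forall>l\<ge>N. \<forall>n. v n * norm (\<sigma> k n - \<sigma> l n) < \<epsilon>" if "0 < \<epsilon>" for \<epsilon>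
  proof -
    have "0 < min \<epsilon> 1" using that by simp
    then obtain N where N: "\<And>k l. N \<le> k \<Longrightarrow> N \<le> l \<Longrightarrow> c0_dist v (\<sigma> k) (\<sigma> l) < min \<epsilon> 1"
      using C unfolding c0.MCauchy_def by blast
    have "v n * norm (\<sigma> k n - \<sigma> l n) < \<epsilon>" if "N \<le> k" "N \<le> l" for k l n
      using c0_dist_less_imp[OF N[OF that], of n] by simp
    then show ?thesis by blast
  qed
  \<comment> \<open>The coordinates converge, and they do so uniformly after weighting.\<close>
  have "\<exists>l. (\<lambda>k. \<sigma> k n) \<longlonglongrightarrow> l" for n
  proof -
    have "Cauchy (\<lambda>k. \<sigma> k n)"
    proof (rule CauchyI)
      fix \<epsilon> :: real assume "0 < \<epsilon>"
      then obtain N where "\<forall>k\<ge>N. \<forall>l\<ge>N. v n * norm (\<sigma> k n - \<sigma> l n) < v n * \<epsilon>"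
        using cau[of "v n * \<epsilon>"] weight_pos[of n] by (meson mult_pos_pos)
      then show "\<exists>N. \<forall>k\<ge>N. \<forall>l\<ge>N. norm (\<sigma> k n - \<sigma> l n) < \<epsilon>"
        using mult_less_cancel_left_pos[OF weight_pos[of n]] by blast
    qed
    then show ?thesis by (simp add: Cauchy_convergent_iff convergent_def)
  qed
  then obtain x where x: "\<And>n. (\<lambda>k. \<sigma> k n) \<longlonglongrightarrow> x n" by metis
  have unif: "\<exists>N. \<forall>k\<ge>N. \<forall>n. v n * norm (\<sigma> k n - x n) \<le> \<epsilon>" if "0 < \<epsilon>" for \<epsilon>
  proof -
    obtain N where N: "\<forall>k\<ge>N. \<forall>l\<ge>N. \<forall>n. v n * norm (\<sigma> k n - \<sigma> l n) < \<epsilon>"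
      using cau[OF \<open>0 < \<epsilon>\<close>] by blast
    have "v n * norm (\<sigma> k n - x n) \<le> \<epsilon>" if "N \<le> k" for k n
    proof (rule LIMSEQ_le_const2)
      show "(\<lambda>l. v n * norm (\<sigma> k n - \<sigma> l n)) \<longlonglongrightarrow> v n * norm (\<sigma> k n - x n)"
        by (intro tendsto_intros x)
      show "\<exists>M. \<forall>l\<ge>M. v n * norm (\<sigma> k n - \<sigma> l n) \<le> \<epsilon>" using N that less_imp_le by blast
    qed
    then show ?thesis by blast
  qed
  have "x \<in> c0_space v"
  proof (rule c0_spaceI)
    fix \<epsilon> :: real assume "0 < \<epsilon>"
    then have "0 < \<epsilon> / 2" by simp
    then obtain k where k: "\<And>n. v n * norm (\<sigma> k n - x n) \<le> \<epsilon> / 2" using unif by blast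
    obtain N where N: "\<forall>n\<ge>N. v n * norm (\<sigma> k n) < \<epsilon> / 2"
      using c0_spaceD[OF mem half_gt_zero[OF \<open>0 < \<epsilon>\<close>]] by blast
    have "v n * norm (x n) < \<epsilon>" if "N \<le> n" for n
    proof -
      have "v n * norm (x n) \<le> v n * (norm (\<sigma> k n) + norm (\<sigma> k n - x n))"
        using weight_pos[of n] norm_triangle_sub[of "x n" "\<sigma> k n"]
        by (simp add: norm_minus_commute)
      then show ?thesis using k[of n] N that by (auto simp: distrib_left dest!: spec[of _ n])
    qed
    then show "\<exists>N. \<forall>n\<ge>N. v n * norm (x n) < \<epsilon>" by blast
  qed
  moreover have "\<exists>N. \<forall>k\<ge>N. c0_dist v (\<sigma> k) x < \<epsilon>" if "0 < \<epsilon>" for \<epsilon>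
  proof -
    obtain N where "\<forall>k\<ge>N. \<forall>n. v n * norm (\<sigma> k n - x n) \<le> \<epsilon> / 2"
      using unif[OF half_gt_zero[OF \<open>0 < \<epsilon>\<close>]] by blast
    then have "\<forall>k\<ge>N. c0_dist v (\<sigma> k) x \<le> \<epsilon> / 2" by (blast intro: c0_dist_le)
    then show ?thesis using that by (intro exI[of _ N]) fastforce
  qed
  ultimately show "\<exists>x. limitin c0.mtopology \<sigma> x sequentially"
    unfolding c0.limit_metric_sequentially by (intro exI[of _ x]) (simp add: mem)
qed

lemma frechet_space_c0:
  "frechet_space seq_scale
    (c0_topology v :: (nat \<Rightarrow> 'k::{real_normed_field, euclidean_space}) topology)"
proof -
  interpret vs: vector_space "seq_scale :: 'k \<Rightarrow> _"
    by unfold_locales (simp_all add: seq_scale_def fun_eq_iff distrib_left distrib_right mult.assoc)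
  show ?thesis
  proof (intro frechet_space.intro frechet_space_axioms.intro)
    show "vector_space (seq_scale :: 'k \<Rightarrow> _)" by (rule vs.vector_space_axioms)
    show "vs.subspace (topspace (c0_topology v))"
      by (auto simp: vs.subspace_def zero_in_c0 add_in_c0 scale_in_c0)
    show "continuous_map (prod_topology (c0_topology v) (c0_topology v)) (c0_topology v)
        (\<lambda>(x :: nat \<Rightarrow> 'k, y). x + y)"
      unfolding c0_topology[symmetric] c0.continuous_map_to_metric
    proof (intro ballI allI impI)
      fix p :: "(nat \<Rightarrow> 'k) \<times> (nat \<Rightarrow> 'k)" and \<epsilon> :: real
      assume p: "p \<in> topspace (prod_topology c0.mtopology c0.mtopology)" and "0 < \<epsilon>"
      obtain x y where xy: "p = (x, y)" "x \<in> c0_space v" "y \<in> c0_space v"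
        using p by auto
      have "c0_dist v (x + y) (a + b) < \<epsilon>"
        if "c0_dist v x a < \<epsilon> / 2" "c0_dist v y b < \<epsilon> / 2" for a b
      proof -
        have "c0_dist v (x + y) (a + b) \<le> c0_dist v (x + y) (a + y) + c0_dist v (a + y) (a + b)"
          by (rule c0_dist_triangle)
        also have "\<dots> = c0_dist v x a + c0_dist v y b"
          using c0_dist_translate[of y a b] by (simp add: c0_dist_translate add.commute)
        finally show ?thesis using that by linarith
      qed
      then show "\<exists>U. openin (prod_topology c0.mtopology c0.mtopology) U \<and> p \<in> U \<and>
          (\<forall>q\<in>U. (case q of (x, y) \<Rightarrow> x + y) \<in> c0.mball (case p of (x, y) \<Rightarrow> x + y) \<epsilon>)"
        using xy \<open>0 < \<epsilon>\<close>
        by (intro exI[of _ "c0.mball x (\<epsilon> / 2) \<times> c0.mball y (\<epsilon> / 2)"])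
           (auto simp: openin_prod_Times_iff add_in_c0)
    qed
    show "continuous_map (prod_topology euclidean (c0_topology v)) (c0_topology v)
        (\<lambda>(c :: 'k, x). seq_scale c x)"
      unfolding c0_topology[symmetric] c0.continuous_map_to_metric
    proof (intro ballI allI impI)
      fix p :: "'k \<times> (nat \<Rightarrow> 'k)" and \<epsilon> :: real
      assume p: "p \<in> topspace (prod_topology euclidean c0.mtopology)" and "0 < \<epsilon>"
      obtain c x where cx: "p = (c, x)" "x \<in> c0_space v"
        using p by auto
      obtain B where B: "0 < B" "\<And>n. v n * norm (x n) \<le> B" using c0_space_bounded[OF cx(2)] by blast
      define \<delta> where "\<delta> = min 1 (\<epsilon> / (4 * (norm c + 1)))"
      define \<eta> where "\<eta> = min 1 (\<epsilon> / (4 * B))"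
      have pos: "0 < \<delta>" "0 < \<eta>" "\<delta> \<le> 1" "\<eta> \<le> 1" using \<open>0 < \<epsilon>\<close> B(1)
        by (auto simp: \<delta>_def \<eta>_def add_nonneg_pos)
      have \<delta>: "(norm c + 1) * \<delta> \<le> \<epsilon> / 4" and \<eta>: "\<eta> * B \<le> \<epsilon> / 4"
        using \<open>0 < \<epsilon>\<close> B(1) by (auto simp: \<delta>_def \<eta>_def min_def field_simps add_pos_nonneg
          intro: order_trans split: if_splits)
      have "c0_dist v (seq_scale c x) (seq_scale a y) < \<epsilon>"
        if a: "dist c a < \<eta>" and y: "c0_dist v x y < \<delta>" for a y
      proof -
        have "v n * norm (c * x n - a * y n) \<le> \<epsilon> / 2" for n
        proof -
          have "c * x n - a * y n = (c - a) * x n + a * (x n - y n)" by (simp add: algebra_simps)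
          then have "norm (c * x n - a * y n) \<le> norm (c - a) * norm (x n) + norm a * norm (x n - y n)"
            using norm_triangle_ineq[of "(c - a) * x n" "a * (x n - y n)"] by (simp add: norm_mult)
          from mult_left_mono[OF this less_imp_le[OF weight_pos[of n]]]
          have "v n * norm (c * x n - a * y n)
              \<le> norm (c - a) * (v n * norm (x n)) + norm a * (v n * norm (x n - y n))"
            by (simp add: distrib_left mult.left_commute)
          moreover have "norm (c - a) * (v n * norm (x n)) \<le> \<eta> * B"
            using a B weight_pos[of n] pos by (intro mult_mono) (auto simp: dist_norm)
          moreover have "norm a * (v n * norm (x n - y n)) \<le> (norm c + 1) * \<delta>"
          proof (intro mult_mono)
            show "norm a \<le> norm c + 1"
              using a pos norm_triangle_ineq2[of a c] by (simp add: dist_norm norm_minus_commute)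
            show "v n * norm (x n - y n) \<le> \<delta>"
              using c0_dist_less_imp[OF y pos(3)] by (simp add: less_imp_le)
          qed (use weight_pos[of n] in auto)
          ultimately show ?thesis using \<delta> \<eta> by linarith
        qed
        then have "c0_dist v (seq_scale c x) (seq_scale a y) \<le> \<epsilon> / 2"
          by (intro c0_dist_le) (simp add: seq_scale_def)
        then show ?thesis using \<open>0 < \<epsilon>\<close> by linarith
      qed
      then show "\<exists>U. openin (prod_topology euclidean c0.mtopology) U \<and> p \<in> U \<and>
          (\<forall>q\<in>U. (case q of (c, x) \<Rightarrow> seq_scale c x) \<in> c0.mball (case p of (c, x) \<Rightarrow> seq_scale c x) \<epsilon>)"
        using cx pos
        by (intro exI[of _ "ball c \<eta> \<times> c0.mball x \<delta>"])
           (simp add: openin_prod_Times_iff scale_in_c0 split_beta)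
    qed
    show "\<exists>V. openin (c0_topology v) V \<and> 0 \<in> V \<and> V \<subseteq> U \<and>
        (\<forall>x\<in>V. \<forall>y\<in>V. \<forall>t\<in>{0..1::real}.
          seq_scale (of_real (1 - t)) x + seq_scale (of_real t) y \<in> V)"
      if U: "openin (c0_topology v) U" "0 \<in> U" for U :: "(nat \<Rightarrow> 'k) set"
    proof -
      obtain r where r: "0 < r" "c0.mball 0 r \<subseteq> U"
        using U unfolding c0_topology[symmetric] c0.openin_mtopology by blast
      define s where "s = min r 1"
      define V where "V = c0.mball (0 :: nat \<Rightarrow> 'k) s"
      have s: "0 < s" "s \<le> r" "s \<le> 1" using r by (auto simp: s_def)
      have "seq_scale (of_real (1 - t)) x + seq_scale (of_real t) y \<in> V"
        if "x \<in> V" "y \<in> V" and t: "0 \<le> t" "t \<le> 1" for x y t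
      proof -
        have x: "x \<in> c0_space v" "c0_dist v 0 x < s" and y: "y \<in> c0_space v" "c0_dist v 0 y < s"
          using that by (auto simp: V_def)
        define e where "e = max (c0_dist v 0 x) (c0_dist v 0 y)"
        have e: "e < s" using x y by (simp add: e_def)
        have bnd: "v n * norm (x n) \<le> e" "v n * norm (y n) \<le> e" for n
          using c0_dist_upper[of n 0 x] c0_dist_upper[of n 0 y] e s
          by (auto simp: e_def min_def split: if_splits)
        have "v n * norm (of_real (1 - t) * x n + of_real t * y n) \<le> e" for n
        proof -
          have "norm (of_real (1 - t) * x n + of_real t * y n) \<le> (1 - t) * norm (x n) + t * norm (y n)"
            using t by (intro norm_triangle_le) (simp add: norm_mult norm_of_real del: of_real_diff)
          from mult_left_mono[OF this less_imp_le[OF weight_pos[of n]]]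
          have "v n * norm (of_real (1 - t) * x n + of_real t * y n)
              \<le> (1 - t) * (v n * norm (x n)) + t * (v n * norm (y n))"
            by (simp add: distrib_left mult.left_commute del: of_real_diff)
          also have "\<dots> \<le> e" using t bnd by (intro convex_bound_le) auto
          finally show ?thesis .
        qed
        then have "c0_dist v 0 (seq_scale (of_real (1 - t)) x + seq_scale (of_real t) y) \<le> e"
          by (intro c0_dist_le) (simp only: seq_scale_def plus_fun_apply zero_fun_apply diff_0 norm_minus_cancel)
        then show ?thesis using e x y by (simp add: V_def zero_in_c0 add_in_c0 scale_in_c0)
      qed
      moreover have "V \<subseteq> U" using r s unfolding V_def by (meson c0.mball_subset_concentric order_trans)
      ultimately show ?thesis
        using s by (intro exI[of _ V]) (auto simp: V_def zero_in_c0)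
    qed
    show "\<exists>d. Metric_space (topspace (c0_topology v)) d \<and>
        (\<forall>x\<in>topspace (c0_topology v). \<forall>y\<in>topspace (c0_topology v). \<forall>z\<in>topspace (c0_topology v).
          d (x + z :: nat \<Rightarrow> 'k) (y + z) = d x y) \<and>
        Metric_space.mcomplete (topspace (c0_topology v)) d \<and>
        Metric_space.mtopology (topspace (c0_topology v)) d = c0_topology v"
      using Metric_space_c0 c0_mcomplete
      by (intro exI[of _ "c0_dist v"]) (simp add: c0_dist_translate c0_topology)
  qed
qed

lemma finite_sequences_dense:
  assumes e: "\<And>y \<epsilon>. 0 < \<epsilon> \<Longrightarrow> \<exists>i. dist (e i) y < \<epsilon>"
    and x: "x \<in> c0_space v" and "0 < \<epsilon>"
  shows "\<exists>xs. c0_dist v x (finite_sequence e xs) < \<epsilon>"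
proof -
  obtain N where N: "\<forall>n\<ge>N. v n * norm (x n) < \<epsilon> / 2"
    using c0_spaceD[OF x half_gt_zero[OF \<open>0 < \<epsilon>\<close>]] by blast
  have "\<exists>i. dist (e i) (x n) < \<epsilon> / (2 * v n)" for n using e weight_pos[of n] \<open>0 < \<epsilon>\<close> by simp
  then obtain f where f: "\<And>n. dist (e (f n)) (x n) < \<epsilon> / (2 * v n)" by metis
  have "c0_dist v x (finite_sequence e (map f [0..<N])) \<le> \<epsilon> / 2"
  proof (rule c0_dist_le)
    fix n
    show "v n * norm (x n - finite_sequence e (map f [0..<N]) n) \<le> \<epsilon> / 2"
      using N f[of n] weight_pos[of n]
      by (cases "n < N")
        (auto simp: finite_sequence_def dist_norm norm_minus_commute field_simps intro!: less_imp_le)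
  qed
  then show ?thesis using \<open>0 < \<epsilon>\<close> by (intro exI[of _ "map f [0..<N]"]) linarith
qed

lemma finite_sequence_in_c0: "finite_sequence e xs \<in> c0_space v"
  by (rule finite_support_in_c0[of "length xs"]) (simp add: finite_sequence_def)

lemma separable_space_c0:
  "separable_space (c0_topology v :: (nat \<Rightarrow> 'k::{real_normed_field, euclidean_space}) topology)"
proof -
  obtain e :: "nat \<Rightarrow> 'k" where e: "\<And>y \<epsilon>. 0 < \<epsilon> \<Longrightarrow> \<exists>i. dist (e i) y < \<epsilon>"
    using obtain_dense_sequence by blast
  have "c0.mtopology closure_of range (finite_sequence e) = c0_space v"
    unfolding c0.metric_closure_of
  proof (intro set_eqI iffI CollectI conjI allI impI)
    fix x :: "nat \<Rightarrow> 'k" and \<epsilon> :: real assume x: "x \<in> c0_space v" and "0 < \<epsilon>"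
    then obtain xs where "c0_dist v x (finite_sequence e xs) < \<epsilon>"
      using finite_sequences_dense[OF e] by blast
    then show "\<exists>y\<in>range (finite_sequence e). y \<in> c0.mball x \<epsilon>"
      using x by (simp add: finite_sequence_in_c0) blast
  qed auto
  then have "c0_topology v closure_of range (finite_sequence e) = c0_space v"
    by (simp only: c0_topology)
  moreover have "range (finite_sequence e) \<subseteq> c0_space v" using finite_sequence_in_c0 by blast
  moreover have "countable (range (finite_sequence e))" by simp
  ultimately show ?thesis unfolding separable_space_def topspace_c0 by blast
qed

lemma backward_shift_continuous_linear:
  "continuous_linear_operator seq_scale
    (c0_topology v :: (nat \<Rightarrow> 'k::{real_normed_field, euclidean_space}) topology) backward_shift"
  unfolding continuous_linear_operator_def
proof (intro conjI ballI allI)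
  show "continuous_map (c0_topology v) (c0_topology v)
      (backward_shift :: (nat \<Rightarrow> 'k) \<Rightarrow> _)"
    unfolding c0_topology[symmetric] c0.continuous_map_to_metric
  proof (intro ballI allI impI)
    fix x :: "nat \<Rightarrow> 'k" and \<epsilon> :: real
    assume "x \<in> topspace c0.mtopology" and "0 < \<epsilon>"
    then have x: "x \<in> c0_space v" by simp
    define \<delta> where "\<delta> = min 1 (\<epsilon> / 4)"
    have \<delta>: "0 < \<delta>" "\<delta> \<le> 1" "2 * \<delta> < \<epsilon>" using \<open>0 < \<epsilon>\<close> by (auto simp: \<delta>_def)
    have "c0_dist v (backward_shift x) (backward_shift y) < \<epsilon>" if y: "c0_dist v x y < \<delta>" for y
    proof -
      have "c0_dist v (backward_shift x) (backward_shift y) \<le> 2 * \<delta>"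
      proof (rule c0_dist_le)
        fix n
        have "v n * norm (x (Suc n) - y (Suc n)) \<le> 2 * v (Suc n) * norm (x (Suc n) - y (Suc n))"
          by (intro mult_right_mono weight_step) simp
        also have "\<dots> \<le> 2 * \<delta>" using c0_dist_less_imp[OF y \<delta>(2), of "Suc n"] by simp
        finally show "v n * norm (backward_shift x n - backward_shift y n) \<le> 2 * \<delta>"
          by (simp add: backward_shift_def)
      qed
      then show ?thesis using \<delta> by linarith
    qed
    then show "\<exists>U. openin c0.mtopology U \<and> x \<in> U \<and>
        (\<forall>y\<in>U. backward_shift y \<in> c0.mball (backward_shift x) \<epsilon>)"
      using x \<delta> by (intro exI[of _ "c0.mball x \<delta>"]) (auto simp: shift_in_c0)
  qed
qed (auto simp: backward_shift_def seq_scale_def)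

text \<open>An element \<open>x\<close> of the dense set close to the first unit vector has \<open>x 0 \<noteq> 0\<close>, and the weighted norm of
  \<open>(S ^^ n) x\<close> is at least \<open>v n * norm (x 0)\<close>.\<close>

lemma criterion_imp_weight_tendsto_0:
  assumes "frequent_hypercyclicity_criterion
    (c0_topology v :: (nat \<Rightarrow> 'k::{real_normed_field, euclidean_space}) topology) backward_shift"
  shows "v \<longlonglongrightarrow> 0"
proof -
  obtain X0 :: "(nat \<Rightarrow> 'k) set" and S where
    dense: "c0_topology v closure_of X0 = c0_space v" and S: "S ` X0 \<subseteq> X0"
    and conv: "\<And>x. x \<in> X0 \<Longrightarrow> converges_unconditionally (c0_topology v) (\<lambda>n. (S ^^ n) x)"
    and inverse: "\<And>x. x \<in> X0 \<Longrightarrow> backward_shift (S x) = x"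
    using assms unfolding frequent_hypercyclicity_criterion_def topspace_c0
    by (elim exE conjE, intro that) auto
  define e0 :: "nat \<Rightarrow> 'k" where "e0 = (\<lambda>n. if n = 0 then 1 else 0)"
  have "e0 \<in> c0_space v" by (rule finite_support_in_c0[of 1]) (simp add: e0_def)
  then have "e0 \<in> c0.mtopology closure_of X0" by (simp only: dense c0_topology)
  then have "\<exists>y\<in>X0. y \<in> c0.mball e0 r" if "0 < r" for r
    using that unfolding c0.metric_closure_of by blast
  from this[of "min 1 (v 0)"] have "\<exists>y\<in>X0. y \<in> c0.mball e0 (min 1 (v 0))"
    using weight_pos[of 0] by simp
  then obtain x where x: "x \<in> X0" "c0_dist v e0 x < min 1 (v 0)" by auto
  have "v 0 * norm (1 - x 0) < v 0"
    using c0_dist_less_imp[OF x(2), of 0] by (simp add: e0_def)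
  then have "x 0 \<noteq> 0" by auto
  have SX: "(S ^^ n) x \<in> X0" for n using x S by (induction n) auto
  have "(backward_shift ^^ n) ((S ^^ n) x) = x" for n
  proof (induction n)
    case (Suc n)
    have "(backward_shift ^^ Suc n) ((S ^^ Suc n) x) = (backward_shift ^^ n) (backward_shift (S ((S ^^ n) x)))"
      by (simp add: funpow_swap1)
    then show ?case using Suc inverse[OF SX[of n]] by simp
  qed simp
  \<comment> \<open>Coordinate 0 of the \<open>n\<close>-th shift is coordinate \<open>n\<close>.\<close>
  then have coord: "((S ^^ n) x) n = x 0" for n
    using backward_shift_funpow[of n "(S ^^ n) x" 0] by simp
  obtain l where l: "limitin c0.mtopology (\<lambda>N. \<Sum>n<N. (S ^^ n) x) l sequentially"
    using conv[OF x(1), unfolded converges_unconditionally_def, rule_format, OF bij_id]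
    unfolding c0_topology id_apply by (elim exE)
  show ?thesis
  proof (rule LIMSEQ_I)
    fix \<epsilon> :: real assume "0 < \<epsilon>"
    define \<delta> where "\<delta> = min 1 (\<epsilon> * norm (x 0))"
    have "0 < \<delta>" using \<open>0 < \<epsilon>\<close> \<open>x 0 \<noteq> 0\<close> by (simp add: \<delta>_def)
    have "\<forall>\<epsilon>>0. \<exists>N. \<forall>n\<ge>N. (\<Sum>k<n. (S ^^ k) x) \<in> c0_space v \<and> c0_dist v (\<Sum>k<n. (S ^^ k) x) l < \<epsilon>"
      using l unfolding c0.limit_metric_sequentially by (rule conjunct2)
    from this[rule_format, OF half_gt_zero[OF \<open>0 < \<delta>\<close>]]
    obtain N where N: "\<forall>n\<ge>N. (\<Sum>k<n. (S ^^ k) x) \<in> c0_space v \<and> c0_dist v (\<Sum>k<n. (S ^^ k) x) l < \<delta> / 2"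
      by (elim exE)
    have "norm (v n - 0) < \<epsilon>" if "N \<le> n" for n
    proof -
      let ?s = "\<lambda>n. \<Sum>k<n. (S ^^ k) x"
      have "c0_dist v (?s (Suc n)) (?s n) \<le> c0_dist v (?s (Suc n)) l + c0_dist v l (?s n)"
        by (rule c0_dist_triangle)
      also have "\<dots> < \<delta>"
        using N[rule_format, OF that] N[rule_format, OF le_SucI[OF that]] c0.commute[of l "?s n"]
        by linarith
      finally have "v n * norm (?s (Suc n) n - ?s n n) < \<delta>"
        by (rule c0_dist_less_imp) (simp add: \<delta>_def)
      then have "v n * norm (x 0) < \<epsilon> * norm (x 0)" by (simp add: coord \<delta>_def)
      then show ?thesis using weight_pos[of n] by (simp add: mult_less_cancel_right)
    qed
    then show "\<exists>N. \<forall>n\<ge>N. norm (v n - 0) < \<epsilon>" by blast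
  qed
qed

end

section \<open>The weight\<close>

text \<open>
  The largest function that vanishes at 0, lies below \<open>h\<close> at positive arguments and increases by at
  most 1 at each step.
\<close>

fun truncated_height :: "(nat \<Rightarrow> nat) \<Rightarrow> nat \<Rightarrow> nat" where
  "truncated_height h 0 = 0"
| "truncated_height h (Suc n) = min (Suc (truncated_height h n)) (h (Suc n))"

text \<open>The truncation reaches \<open>L\<close> as soon as \<open>h\<close> has been at least \<open>L\<close> for \<open>L\<close> consecutive steps.\<close>

lemma truncated_height_ge:
  assumes "L \<le> n" and "\<And>m. m \<le> n \<Longrightarrow> n < m + L \<Longrightarrow> L \<le> h m"
  shows "L \<le> truncated_height h n"
proof -
  have "j \<le> truncated_height h (n - L + j)" if "j \<le> L" for j
    using that
  proof (induction j)
    case (Suc j)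
    have "L \<le> h (n - L + Suc j)" using Suc.prems assms(1) by (intro assms(2)) auto
    then show ?case using Suc by simp
  qed simp
  from this[of L] show ?thesis using assms(1) by simp
qed

text \<open>The interval from \<open>16 ^ p / 2\<close> to \<open>3 * 16 ^ p\<close>.\<close>

definition scale_band :: "nat \<Rightarrow> nat set" where
  "scale_band p = {n. 16 ^ p \<le> 2 * n \<and> n \<le> 3 * 16 ^ p}"

text \<open>The numbers within distance \<open>2 * p\<close> of a positive multiple of \<open>16 ^ p\<close>; the inequalities are
  arranged to avoid subtraction of natural numbers.\<close>

definition collar :: "nat \<Rightarrow> nat set" where
  "collar p = {n. \<exists>j\<ge>1. j * 16 ^ p \<le> n + 2 * p \<and> n \<le> j * 16 ^ p + 2 * p}"

text \<open>The largest index of a band or a collar containing \<open>n\<close>, or 0 if there is none. The bound \<open>p \<le> n\<close> is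
  no restriction by \<open>le_levelI\<close>; it makes the set visibly finite.\<close>

definition level :: "nat \<Rightarrow> nat" where
  "level n = Max {p. p \<le> n \<and> (p = 0 \<or> n \<in> scale_band p \<or> n \<in> collar p)}"

text \<open>Twice the level, cut down so that it starts at 0 and never increases by more than 1 at a step.\<close>

definition height :: "nat \<Rightarrow> nat" where
  "height = truncated_height (\<lambda>n. 2 * level n)"

lemma linear_less_power_16: "3 * p < 16 ^ p" for p :: nat
  by (induction p) auto

lemma le_levelI:
  assumes "n \<in> scale_band p \<or> n \<in> collar p" shows "p \<le> level n"
proof -
  have "p \<le> n"
    using assms
  proof
    assume "n \<in> scale_band p"
    then show ?thesis using linear_less_power_16[of p] by (simp add: scale_band_def)
  next
    assume "n \<in> collar p"
    then obtain j where j: "1 \<le> j" "j * 16 ^ p \<le> n + 2 * p" by (auto simp: collar_def)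
    have "1 * 16 ^ p \<le> j * 16 ^ p" using j(1) by (rule mult_right_mono) simp
    then show ?thesis using j(2) linear_less_power_16[of p] by linarith
  qed
  then show ?thesis unfolding level_def using assms by (intro Max_ge) auto
qed

lemma level_cases:
  assumes "0 < level n" shows "n \<in> scale_band (level n) \<or> n \<in> collar (level n)"
proof -
  have "level n \<in> {p. p \<le> n \<and> (p = 0 \<or> n \<in> scale_band p \<or> n \<in> collar p)}"
    unfolding level_def by (rule Max_in) auto
  then show ?thesis using assms by auto
qed

lemma height_Suc_le: "height (Suc n) \<le> Suc (height n)"
  by (simp add: height_def)

lemma height_le: "height n \<le> 2 * level n"
  by (cases n) (auto simp: height_def)

lemma height_near_multiple:
  assumes "1 \<le> j" "i < p" shows "2 * p \<le> height (j * 16 ^ p + i)"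
  unfolding height_def
proof (rule truncated_height_ge)
  have "1 * 16 ^ p \<le> j * 16 ^ p" using assms(1) by (rule mult_right_mono) simp
  then show "2 * p \<le> j * 16 ^ p + i" using linear_less_power_16[of p] by linarith
  fix m assume "m \<le> j * 16 ^ p + i" "j * 16 ^ p + i < m + 2 * p"
  then have "m \<in> collar p" using assms by (auto simp: collar_def intro!: exI[of _ j])
  then show "2 * p \<le> 2 * level m" by (simp add: le_levelI)
qed

lemma height_in_scale:
  assumes "1 \<le> u" "7 * 16 ^ u \<le> 8 * m" "m \<le> 3 * 16 ^ u" shows "2 * u \<le> height m"
  unfolding height_def
proof (rule truncated_height_ge)
  \<comment> \<open>This lets the \<open>2 * u\<close> steps before \<open>m\<close> fit into the band, which starts at \<open>16 ^ u / 2\<close>.\<close>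
  have bound: "8 * u \<le> 16 ^ u" using assms(1) by (induction u rule: dec_induct) auto
  then show "2 * u \<le> m" using assms(2) by linarith
  fix k assume "k \<le> m" "m < k + 2 * u"
  then have "k \<in> scale_band u" using assms bound by (simp add: scale_band_def)
  then show "2 * u \<le> 2 * level k" by (simp add: le_levelI)
qed

text \<open>The number whose \<open>k\<close> hexadecimal digits are all 6. Its remainder modulo \<open>16 ^ q\<close>, for \<open>q \<le> k\<close>, is
  \<open>landmark q\<close>, slightly less than \<open>2 / 5 * 16 ^ q\<close>; so its distance from every multiple of \<open>16 ^ q\<close> is
  at least \<open>landmark q\<close>. It also lies outside all bands.\<close>

definition landmark :: "nat \<Rightarrow> nat" where
  "landmark k = (2 * 16 ^ k - 2) div 5"

lemma landmark_eq: "5 * landmark k + 2 = 2 * 16 ^ k"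
proof -
  have "\<exists>m. 2 * 16 ^ k = 5 * m + (2::nat)"
  proof (induction k)
    case (Suc k)
    then obtain m where "2 * 16 ^ k = 5 * m + (2::nat)" by blast
    then show ?case by (intro exI[of _ "16 * m + 6"]) simp
  qed simp
  then show ?thesis by (auto simp: landmark_def)
qed

lemma landmark_mod:
  assumes "q \<le> k" shows "\<exists>t. landmark k = t * 16 ^ q + landmark q"
proof -
  obtain d where k: "k = q + d" using assms le_Suc_ex by blast
  have "5 * landmark k = 5 * (landmark d * 16 ^ q + landmark q)"
    using landmark_eq[of k] landmark_eq[of q] arg_cong[OF landmark_eq[of d], of "\<lambda>x. x * 16 ^ q"]
    by (simp add: k power_add algebra_simps)
  then have "landmark k = landmark d * 16 ^ q + landmark q" by (metis mult_left_cancel zero_neq_numeral)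
  then show ?thesis by blast
qed

lemma landmark_not_in_band: "landmark k \<notin> scale_band u"
proof (cases "u < k")
  case True
  then have "16 * 16 ^ u \<le> (16 ^ k :: nat)"
    by (metis Suc_leI power_Suc power_increasing one_le_numeral)
  moreover have "1 \<le> (16 ^ u :: nat)" by simp
  ultimately have "3 * 16 ^ u < landmark k" using landmark_eq[of k] by linarith
  then show ?thesis by (simp add: scale_band_def)
next
  case False
  then have "(16 ^ k :: nat) \<le> 16 ^ u" by (intro power_increasing) auto
  then have "2 * landmark k < 16 ^ u" using landmark_eq[of k] by linarith
  then show ?thesis by (simp add: scale_band_def)
qed

text \<open>A multiple of \<open>16 ^ q\<close> whose collar meets \<open>{..landmark k}\<close> is followed by at least \<open>landmark q\<close> further
  integers up to \<open>landmark k\<close>.\<close>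

lemma collar_below_landmark:
  assumes "1 \<le> q" "e \<le> landmark k" "1 \<le> j" "j * 16 ^ q \<le> e + 2 * q"
  shows "q < k" "j * 16 ^ q + landmark q \<le> landmark k"
proof -
  have far: "landmark q + 2 * q < 16 ^ q"
  proof -
    have "4 * q \<le> 16 ^ q" using assms(1) by (induction q rule: dec_induct) auto
    then show ?thesis using landmark_eq[of q] by linarith
  qed
  have le: "j * 16 ^ q \<le> landmark k + 2 * q" using assms(2,4) by linarith
  show "q < k"
  proof (rule ccontr)
    assume "\<not> q < k"
    then have "(16 ^ k :: nat) \<le> 16 ^ q" by (intro power_increasing) auto
    then have "landmark k \<le> landmark q" using landmark_eq[of k] landmark_eq[of q] by linarith
    moreover have "1 * 16 ^ q \<le> j * 16 ^ q" using assms(3) by (rule mult_right_mono) simp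
    ultimately show False using le far by linarith
  qed
  then obtain t where t: "landmark k = t * 16 ^ q + landmark q" using landmark_mod[of q k] by auto
  then have "j * 16 ^ q < (t + 1) * 16 ^ q" using le far by simp
  then have "j < t + 1" by (rule mult_right_less_imp_less) simp
  then have "j \<le> t" by simp
  then have "j * 16 ^ q \<le> t * 16 ^ q" by (rule mult_right_mono) simp
  then show "j * 16 ^ q + landmark q \<le> landmark k" using t by simp
qed

lemma height_landmark: "height (landmark k) = 0"
proof (rule ccontr)
  assume "height (landmark k) \<noteq> 0"
  then have "0 < level (landmark k)" using height_le[of "landmark k"] by simp
  then obtain q where q: "1 \<le> q" "landmark k \<in> collar q"
    using level_cases landmark_not_in_band by (metis One_nat_def Suc_leI)
  then obtain j where j: "1 \<le> j" "j * 16 ^ q \<le> landmark k + 2 * q" "landmark k \<le> j * 16 ^ q + 2 * q"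
    by (auto simp: collar_def)
  have "j * 16 ^ q + landmark q \<le> landmark k"
    by (rule collar_below_landmark(2)) (use q j in auto)
  moreover have "5 * q + 2 \<le> 16 ^ q" using q(1) by (induction q rule: dec_induct) auto
  ultimately show False using j(3) landmark_eq[of q] by linarith
qed

section \<open>Collars carry little weight\<close>

text \<open>
  The translates of the collars below \<open>landmark k\<close> by \<open>0, w, 2 * w, ..., (2 ^ q - 1) * w\<close>, where \<open>w\<close> is
  the width of one collar, are pairwise disjoint and stay below \<open>landmark k\<close>. Since the weights
  increase, each translate weighs at least as much as the collars themselves.
\<close>

lemma collar_weight_le:
  fixes \<alpha> :: "nat \<Rightarrow> real"
  assumes q: "2 \<le> q" and mono: "\<And>i j. i \<le> j \<Longrightarrow> \<alpha> i \<le> \<alpha> j" and nonneg: "\<And>i. 0 \<le> \<alpha> i"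
  shows "(\<Sum>i\<in>{1..landmark k} \<inter> collar q. \<alpha> i) \<le> (\<Sum>i=1..landmark k. \<alpha> i) / 2 ^ q"
proof -
  define n where "n = landmark k"
  define A where "A = {1..n} \<inter> collar q"
  define w where "w = 4 * q + 1"
  define f where "f = (\<lambda>(e, j). e + w * j)"
  have w: "2 ^ q * w \<le> 8 ^ q"
  proof -
    have "w \<le> 4 ^ q" using q unfolding w_def by (induction q rule: dec_induct) auto
    then have "2 ^ q * w \<le> 2 ^ q * 4 ^ q" by (rule mult_left_mono) simp
    then show ?thesis by (simp flip: power_mult_distrib)
  qed
  have lq: "2 ^ q * w \<le> landmark q"
  proof -
    have "5 * 8 ^ q + 2 \<le> 2 * (16 ^ q :: nat)"
      using q by (induction q rule: dec_induct) auto
    then show ?thesis using w landmark_eq[of q] by linarith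
  qed
  have lq2: "landmark q < 16 ^ q" using landmark_eq[of q] by linarith
  have A: "\<exists>m s. 1 \<le> m \<and> s < w \<and> e + 2 * q = m * 16 ^ q + s" if e: "e \<in> A" for e
  proof -
    obtain m where m: "1 \<le> m" "m * 16 ^ q \<le> e + 2 * q" "e \<le> m * 16 ^ q + 2 * q"
      using e by (auto simp: A_def collar_def)
    then show ?thesis
      by (intro exI[of _ m] exI[of _ "e + 2 * q - m * 16 ^ q"]) (auto simp: w_def)
  qed
  have offset: "s + w * j < 16 ^ q" if "s < w" "j < 2 ^ q" for s j
  proof -
    have "s + w * j < w * (j + 1)" using that by simp
    also have "\<dots> \<le> w * 2 ^ q" using that by (intro mult_left_mono) auto
    finally show ?thesis using lq lq2 by (simp add: mult.commute)
  qed
  have "inj_on f (A \<times> {..<2 ^ q})"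
  proof (rule inj_onI)
    fix z z' assume z: "z \<in> A \<times> {..<2 ^ q}" "z' \<in> A \<times> {..<2 ^ q}" "f z = f z'"
    obtain e j e' j' where zz: "z = (e, j)" "z' = (e', j')" by (cases z, cases z')
    have e: "e \<in> A" "e' \<in> A" and j: "j < 2 ^ q" "j' < 2 ^ q" and eq: "f (e, j) = f (e', j')"
      using z by (auto simp: zz)
    obtain m s where ms: "s < w" "e + 2 * q = m * 16 ^ q + s" using A[OF e(1)] by blast
    obtain m' s' where ms': "s' < w" "e' + 2 * q = m' * 16 ^ q + s'" using A[OF e(2)] by blast
    have "m * 16 ^ q + (s + w * j) = m' * 16 ^ q + (s' + w * j')"
      using eq ms(2) ms'(2) by (simp add: f_def)
    then have "(m * 16 ^ q + (s + w * j)) mod 16 ^ q = (m' * 16 ^ q + (s' + w * j')) mod 16 ^ q"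
      by simp
    then have *: "s + w * j = s' + w * j'" using offset ms ms' j by simp
    then have "(s + w * j) div w = (s' + w * j') div w" by simp
    then have "j = j'" using ms(1) ms'(1) by simp
    then show "z = z'" using eq by (simp add: f_def zz)
  qed
  moreover have "f ` (A \<times> {..<2 ^ q}) \<subseteq> {1..n}"
  proof (clarify)
    fix e j assume e: "e \<in> A" and j: "j < (2 ^ q :: nat)"
    obtain m where m: "1 \<le> m" "m * 16 ^ q \<le> e + 2 * q" "e \<le> m * 16 ^ q + 2 * q"
      using e by (auto simp: A_def collar_def)
    have "m * 16 ^ q + landmark q \<le> n"
      unfolding n_def by (rule collar_below_landmark(2)) (use q m e in \<open>auto simp: A_def n_def\<close>)
    moreover have "w * (j + 1) \<le> w * 2 ^ q" using j by (intro mult_left_mono) auto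
    then have "2 * q + w * j \<le> landmark q" using lq by (simp add: w_def mult.commute)
    ultimately show "f (e, j) \<in> {1..n}" using e m(3) by (auto simp: f_def A_def)
  qed
  ultimately have "(\<Sum>z\<in>A \<times> {..<2 ^ q}. \<alpha> (f z)) \<le> (\<Sum>i=1..n. \<alpha> i)"
    using nonneg sum_mono2[of "{1..n}" "f ` (A \<times> {..<2 ^ q})" \<alpha>] by (simp add: sum.reindex)
  moreover have "(\<Sum>z\<in>A \<times> {..<2 ^ q :: nat}. \<alpha> (fst z)) \<le> (\<Sum>z\<in>A \<times> {..<2 ^ q}. \<alpha> (f z))"
    by (intro sum_mono) (auto simp: f_def intro: mono)
  moreover have "(\<Sum>z\<in>A \<times> {..<2 ^ q :: nat}. \<alpha> (fst z)) = 2 ^ q * (\<Sum>i\<in>A. \<alpha> i)"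
    using sum.cartesian_product[of "\<lambda>e j. \<alpha> e" "{..<2 ^ q :: nat}" A]
    by (simp add: sum_distrib_left case_prod_beta)
  ultimately show ?thesis by (simp add: A_def n_def field_simps)
qed

section \<open>Hitting times\<close>

text \<open>
  The multiples of \<open>16 ^ p\<close> in the intervals \<open>[16 ^ u, 2 * 16 ^ u)\<close>, where \<open>u\<close> has 2-adic valuation \<open>p\<close>.
  The valuation assigns each interval to a single \<open>p\<close>, and to each \<open>p\<close> a periodic set of \<open>u\<close>.
  The condition \<open>u > 0\<close> is needed since \<open>multiplicity 2 0 = 0\<close>.
\<close>

definition hitting_times :: "nat \<Rightarrow> nat set" where
  "hitting_times p =
    {n. \<exists>u>0. multiplicity 2 u = p \<and> 16 ^ u \<le> n \<and> n < 2 * 16 ^ u \<and> 16 ^ p dvd n}"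

lemma hitting_timesE:
  assumes "n \<in> hitting_times p"
  obtains u where "p < u" "multiplicity 2 u = p" "16 ^ u \<le> n" "n < 2 * 16 ^ u" "16 ^ p dvd n"
proof -
  obtain u where u: "0 < u" "multiplicity 2 u = p" "16 ^ u \<le> n" "n < 2 * 16 ^ u" "16 ^ p dvd n"
    using assms unfolding hitting_times_def by blast
  have "2 ^ p dvd u" using u(2) multiplicity_dvd by blast
  then have "2 ^ p \<le> u" using u(1) by (rule dvd_imp_le)
  then have "p < u" using less_exp[of p] by linarith
  then show thesis using that u by blast
qed

lemma power_16_less_iff: "16 * 16 ^ u \<le> (16 ^ v :: nat) \<longleftrightarrow> u < v"
  using power_increasing_iff[of "16::nat" "Suc u" v] by (simp add: Suc_le_eq)

lemma hitting_times_disjoint: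
  assumes "n \<in> hitting_times p" "n \<in> hitting_times q" shows "p = q"
proof -
  obtain u where u: "multiplicity 2 u = p" "16 ^ u \<le> n" "n < 2 * 16 ^ u"
    using assms(1) by (rule hitting_timesE)
  obtain v where v: "multiplicity 2 v = q" "16 ^ v \<le> n" "n < 2 * 16 ^ v"
    using assms(2) by (rule hitting_timesE)
  have "\<not> u < v" "\<not> v < u"
    using u(2,3) v(2,3) power_16_less_iff[of u v] power_16_less_iff[of v u] by linarith+
  then show ?thesis using u(1) v(1) by simp
qed

text \<open>For two times in the same interval the difference is a multiple of \<open>16 ^ p\<close>; for times in different
  intervals it lies between \<open>7 / 8 * 16 ^ v\<close> and \<open>2 * 16 ^ v\<close>, where \<open>v\<close> is the exponent of the
  interval of the larger one.\<close>

lemma hitting_times_separated: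
  assumes "m \<in> hitting_times p" "n \<in> hitting_times q" "m < n"
  shows "m + p \<le> n" and "i < q \<Longrightarrow> p + q \<le> height (n - m + i)"
proof -
  obtain u where u: "p < u" "multiplicity 2 u = p" "16 ^ u \<le> m" "m < 2 * 16 ^ u" "16 ^ p dvd m"
    using assms(1) by (rule hitting_timesE)
  obtain v where v: "q < v" "multiplicity 2 v = q" "16 ^ v \<le> n" "n < 2 * 16 ^ v" "16 ^ q dvd n"
    using assms(2) by (rule hitting_timesE)
  have "\<not> v < u" using u(3) v(4) assms(3) power_16_less_iff[of v u] by linarith
  then consider "u = v" | "u < v" by linarith
  then have "m + p \<le> n \<and> (i < q \<longrightarrow> p + q \<le> height (n - m + i))"
  proof cases
    case 1
    then have pq: "p = q" using u v by simp
    have "16 ^ p dvd n - m" using u(5) v(5) pq by (simp add: dvd_diff_nat)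
    then obtain j where j: "n - m = j * 16 ^ p" by (metis dvd_def mult.commute)
    have "1 \<le> j" using j assms(3) by (cases j) auto
    moreover have "1 * 16 ^ p \<le> j * 16 ^ p" using \<open>1 \<le> j\<close> by (rule mult_right_mono) simp
    then have "m + p \<le> n" using j assms(3) linear_less_power_16[of p] by linarith
    ultimately show ?thesis using height_near_multiple[of j i p] pq by (simp add: j mult_2)
  next
    case 2
    then have le: "16 * 16 ^ u \<le> (16 ^ v :: nat)" by (simp add: power_16_less_iff)
    have "p + q \<le> height (n - m + i)" if "i < q"
    proof -
      obtain d where d: "n = m + d" using assms(3) less_imp_add_positive by blast
      have "7 * 16 ^ v \<le> 8 * d" using le u(4) v(3) unfolding d by linarith
      then have "7 * 16 ^ v \<le> 8 * (n - m + i)" by (simp add: d)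
      moreover have "n - m + i \<le> 3 * 16 ^ v"
        using v(1,4) that linear_less_power_16[of v] by linarith
      ultimately show ?thesis using height_in_scale[of v "n - m + i"] 2 u(1) v(1) by linarith
    qed
    moreover have "m + p \<le> n" using le u(1,4) v(3) linear_less_power_16[of u] by linarith
    ultimately show ?thesis by blast
  qed
  then show "m + p \<le> n" and "i < q \<Longrightarrow> p + q \<le> height (n - m + i)" by auto
qed

lemma lower_density_mono:
  assumes "A \<subseteq> B" "\<And>k. 0 \<le> \<alpha> k" shows "lower_density \<alpha> A \<le> lower_density \<alpha> B"
  unfolding lower_density_def
  by (intro Liminf_mono always_eventually allI)
     (use assms in \<open>auto intro!: divide_right_mono sum_mono2 sum_nonneg\<close>)

text \<open>The last complete interval below \<open>n\<close> already contains a fixed proportion of hitting times, because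
  consecutive exponents \<open>u\<close> of valuation \<open>p\<close> differ by \<open>2 ^ Suc p\<close>.\<close>

lemma card_hitting_times:
  assumes n: "2 * 16 ^ 2 ^ p \<le> n"
  shows "n \<le> 2 * 16 ^ (p + 2 ^ Suc p) * card ({1..n} \<inter> hitting_times p)"
proof -
  \<comment> \<open>The exponents of valuation \<open>p\<close>, in increasing order.\<close>
  define U where "U = (\<lambda>j. 2 ^ p * (2 * j + 1) :: nat)"
  define S where "S = {j. 2 * 16 ^ U j \<le> n}"
  have "j < n" if "j \<in> S" for j
  proof -
    have "1 * j \<le> 2 ^ p * (2 * j + 1)" by (rule mult_mono) auto
    then have "j \<le> U j" by (simp only: U_def mult_1)
    then show ?thesis using that linear_less_power_16[of "U j"] unfolding S_def by simp
  qed
  then have fin: "finite S" by (meson finite_nat_iff_bounded lessThan_iff subsetI)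
  have "0 \<in> S" using n by (simp add: S_def U_def)
  define j where "j = Max S"
  have "j \<in> S" using Max_in[OF fin] \<open>0 \<in> S\<close> unfolding j_def by blast
  have "Suc j \<notin> S" using Max_ge[OF fin, of "Suc j"] unfolding j_def by linarith
  define u where "u = U j"
  have le: "2 * 16 ^ u \<le> n" using \<open>j \<in> S\<close> by (simp add: S_def u_def)
  have gt: "n < 2 * 16 ^ (u + 2 ^ Suc p)"
    using \<open>Suc j \<notin> S\<close> by (simp add: S_def u_def U_def algebra_simps)
  have "multiplicity 2 u = p"
    unfolding u_def U_def
  proof (rule multiplicity_eqI)
    show "\<not> 2 ^ Suc p dvd 2 ^ p * (2 * j + 1)"
      unfolding power_Suc2 by (subst dvd_times_left_cancel_iff) auto
  qed simp
  have "0 < u" by (simp add: u_def U_def)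
  have "2 ^ p \<le> u" by (simp add: u_def U_def)
  then have "p \<le> u" using less_exp[of p] by linarith
  define f where "f = (\<lambda>i. 16 ^ u + i * 16 ^ p :: nat)"
  have pu: "(16::nat) ^ (u - p) * 16 ^ p = 16 ^ u" using \<open>p \<le> u\<close> by (simp flip: power_add)
  have "f ` {..<16 ^ (u - p)} \<subseteq> {1..n} \<inter> hitting_times p"
  proof (clarify)
    fix i assume i: "i < (16::nat) ^ (u - p)"
    have "i * 16 ^ p < 16 ^ (u - p) * 16 ^ p" using i by (intro mult_strict_right_mono) auto
    then have less: "f i < 2 * 16 ^ u" using pu by (simp add: f_def)
    have "(16::nat) ^ p dvd 16 ^ u" using \<open>p \<le> u\<close> by (rule le_imp_power_dvd)
    then have "16 ^ p dvd f i" by (simp add: f_def)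
    then have "f i \<in> hitting_times p" unfolding hitting_times_def
      using less \<open>0 < u\<close> \<open>multiplicity 2 u = p\<close> by (auto simp: f_def)
    moreover have "1 \<le> f i" by (simp add: f_def trans_le_add1)
    ultimately show "f i \<in> {1..n} \<inter> hitting_times p" using less le by simp
  qed
  then have "card (f ` {..<16 ^ (u - p)}) \<le> card ({1..n} \<inter> hitting_times p)"
    by (intro card_mono) auto
  moreover have "card (f ` {..<16 ^ (u - p)}) = 16 ^ (u - p)"
    by (subst card_image) (auto simp: f_def inj_on_def)
  ultimately have "16 ^ (u - p) \<le> card ({1..n} \<inter> hitting_times p)" by simp
  then have "2 * 16 ^ (p + 2 ^ Suc p) * 16 ^ (u - p)
      \<le> 2 * 16 ^ (p + 2 ^ Suc p) * card ({1..n} \<inter> hitting_times p)"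
    by (rule mult_left_mono) simp
  moreover have "2 * 16 ^ (p + 2 ^ Suc p) * 16 ^ (u - p) = (2 * 16 ^ (u + 2 ^ Suc p) :: nat)"
    using \<open>p \<le> u\<close> by (simp flip: power_add)
  ultimately show ?thesis using gt by linarith
qed

lemma lower_density_hitting_times: "0 < lower_density (\<lambda>k. 1) (hitting_times p)"
proof -
  define C where "C = (2 * 16 ^ (p + 2 ^ Suc p) :: nat)"
  have "0 < C" by (simp add: C_def)
  have "\<forall>\<^sub>F n in sequentially. ereal (1 / C)
      \<le> ereal ((\<Sum>k\<in>{1..n} \<inter> hitting_times p. 1) / (\<Sum>j=1..n. 1))"
    using eventually_ge_at_top[of "2 * 16 ^ 2 ^ p"]
  proof eventually_elim
    case (elim n)
    have "1 \<le> n" using elim one_le_power[of "16::nat" "2 ^ p"] by linarith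
    have "real n \<le> C * card ({1..n} \<inter> hitting_times p)"
      using card_hitting_times[OF elim] unfolding C_def by (metis of_nat_le_iff of_nat_mult)
    then show ?case using \<open>1 \<le> n\<close> \<open>0 < C\<close> by (simp add: field_simps)
  qed
  then have "ereal (1 / C) \<le> lower_density (\<lambda>k. 1) (hitting_times p)"
    unfolding lower_density_def by (rule Liminf_bounded)
  moreover have "0 < ereal (1 / C)" using \<open>0 < C\<close> by simp
  ultimately show ?thesis by (rule less_le_trans[rotated])
qed

section \<open>A frequently hypercyclic vector\<close>

text \<open>Since the height increases by at most 1, \<open>weight n \<le> 2 * weight (Suc n)\<close>.\<close>

definition weight :: "nat \<Rightarrow> real" where
  "weight n = (1 / 2) ^ height n"

interpretation weight: c0_weight weight
proof
  fix n
  show "0 < weight n" by (simp add: weight_def)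
  have "(1 / 2 :: real) ^ Suc (height n) \<le> (1 / 2) ^ height (Suc n)"
    using height_Suc_le by (intro power_decreasing) auto
  then show "weight n \<le> 2 * weight (Suc n)" by (simp add: weight_def)
qed

lemma weight_le: "L \<le> height n \<Longrightarrow> weight n \<le> (1 / 2) ^ L"
  unfolding weight_def by (rule power_decreasing) auto

text \<open>The blocks \<open>z p\<close>, written at all hitting times of index \<open>p\<close>, do not overlap.\<close>

lemma exists_concatenation:
  fixes z :: "nat \<Rightarrow> nat \<Rightarrow> 'a::zero"
  obtains x where "\<And>p n i. n \<in> hitting_times p \<Longrightarrow> i < p \<Longrightarrow> x (n + i) = z p i"
    and "\<And>k. x k \<noteq> 0 \<Longrightarrow> \<exists>p n i. n \<in> hitting_times p \<and> i < p \<and> k = n + i"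
proof -
  define Q where "Q = (\<lambda>k y. \<exists>p n i. n \<in> hitting_times p \<and> i < p \<and> k = n + i \<and> y = z p i)"
  have unique: "n = n' \<and> p = p'"
    if "n \<in> hitting_times p" "i < p" "n' \<in> hitting_times p'" "i' < p'" "n + i = n' + i'"
    for n n' p p' i i'
  proof -
    have "\<not> n < n'" "\<not> n' < n"
      using that hitting_times_separated(1)[of n p n' p'] hitting_times_separated(1)[of n' p' n p]
      by linarith+
    then show ?thesis using that hitting_times_disjoint by auto
  qed
  show thesis
  proof
    show "(if \<exists>y. Q k y then SOME y. Q k y else 0) \<noteq> 0
        \<Longrightarrow> \<exists>p n i. n \<in> hitting_times p \<and> i < p \<and> k = n + i" for k
      by (auto simp: Q_def split: if_splits)
    fix p n i assume n: "n \<in> hitting_times p" "i < p"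
    then have "Q (n + i) (z p i)" unfolding Q_def by blast
    moreover have "y = z p i" if "Q (n + i) y" for y
      using that n unique unfolding Q_def by (metis add_left_cancel)
    ultimately show "(if \<exists>y. Q (n + i) y then SOME y. Q (n + i) y else 0) = z p i"
      by (metis someI_ex)
  qed
qed

text \<open>After \<open>m\<close> shifts with \<open>m \<in> hitting_times p\<close>, the copies to the left have been shifted out, the copy at \<open>m\<close>
  is in place, and a copy of \<open>z q\<close> further to the right sits where the weight is at most
  \<open>(1 / 2) ^ (p + q)\<close>, which compensates its size \<open>2 ^ q\<close>.\<close>

lemma concatenation_approximates:
  fixes z :: "nat \<Rightarrow> nat \<Rightarrow> 'k::{real_normed_field, euclidean_space}"
  assumes support: "\<And>p i. p \<le> i \<Longrightarrow> z p i = 0" and bound: "\<And>p i. norm (z p i) \<le> 2 ^ p"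
  obtains x where "x \<in> c0_space weight"
    and "\<And>p m. m \<in> hitting_times p \<Longrightarrow>
      c0_dist weight ((backward_shift ^^ m) x) (z p) \<le> (1 / 2) ^ p"
proof -
  obtain x where x: "\<And>p n i. n \<in> hitting_times p \<Longrightarrow> i < p \<Longrightarrow> x (n + i) = z p i"
    and x0: "\<And>k. x k \<noteq> 0 \<Longrightarrow> \<exists>p n i. n \<in> hitting_times p \<and> i < p \<and> k = n + i"
    using exists_concatenation[of z] by metis
  have "x \<in> c0_space weight"
  proof (rule weight.c0_spaceI)
    fix \<epsilon> :: real assume "0 < \<epsilon>"
    then obtain L where L: "(1 / 2) ^ L < \<epsilon>" using real_arch_pow_inv[of \<epsilon> "1 / 2"] by auto
    have "weight k * norm (x k) < \<epsilon>" if k: "3 * 16 ^ L \<le> k" for k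
    proof (cases "x k = 0")
      case False
      then obtain p n i where n: "n \<in> hitting_times p" "i < p" "k = n + i" using x0 by blast
      obtain u where u: "p < u" "16 ^ u \<le> n" "n < 2 * 16 ^ u" using n(1) by (rule hitting_timesE)
      have up: "k < 3 * 16 ^ u" using u n(2,3) linear_less_power_16[of u] by linarith
      then have "L < u" using k power_less_imp_less_exp[of "16::nat" L u] by linarith
      have "2 * u \<le> height k" using up u n(3) by (intro height_in_scale) auto
      then have "u + p \<le> height k" using u(1) by linarith
      then have "weight k * norm (x k) \<le> (1 / 2) ^ (u + p) * 2 ^ p"
        using bound[of p i] x[OF n(1,2)] n(3)
        by (intro mult_mono weight_le) (auto simp: weight_def)
      also have "\<dots> = (1 / 2) ^ u" by (simp add: power_add power_divide)
      also have "\<dots> \<le> (1 / 2) ^ L" using \<open>L < u\<close> by (intro power_decreasing) auto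
      finally show ?thesis using L by linarith
    qed (use \<open>0 < \<epsilon>\<close> in simp)
    then show "\<exists>N. \<forall>n\<ge>N. weight n * norm (x n) < \<epsilon>" by blast
  qed
  moreover have "c0_dist weight ((backward_shift ^^ m) x) (z p) \<le> (1 / 2) ^ p"
    if m: "m \<in> hitting_times p" for m p
  proof (rule weight.c0_dist_le)
    fix j
    show "weight j * norm ((backward_shift ^^ m) x j - z p j) \<le> (1 / 2) ^ p"
    proof (cases "j < p \<or> x (m + j) = 0")
      case True
      then have "x (m + j) = z p j" using x[OF m] support[of p j] by fastforce
      then show ?thesis by (simp add: backward_shift_funpow add.commute)
    next
      case False
      then obtain q n i where n: "n \<in> hitting_times q" "i < q" "m + j = n + i" using x0 by blast
      have "\<not> n < m" using hitting_times_separated(1)[OF n(1) m] n(2,3) by linarith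
      moreover have "n \<noteq> m" using hitting_times_disjoint[OF m, of q] n False by auto
      ultimately have "m < n" by linarith
      then have j: "j = n - m + i" using n(3) by linarith
      have "p + q \<le> height j"
        unfolding j by (rule hitting_times_separated(2)[OF m n(1) \<open>m < n\<close> n(2)])
      then have "weight j * norm (z q i) \<le> (1 / 2) ^ (p + q) * 2 ^ q"
        using bound[of q i] by (intro mult_mono weight_le) (auto simp: weight_def)
      also have "\<dots> = (1 / 2) ^ p" by (simp add: power_add power_divide)
      finally show ?thesis
        using x[OF n(1,2)] n(3) False support[of p j] by (simp add: backward_shift_funpow add.commute)
    qed
  qed
  ultimately show thesis by (rule that)
qed

lemma frequently_hypercyclic_shift:
  "frequently_hypercyclic
    (c0_topology weight :: (nat \<Rightarrow> 'k::{real_normed_field, euclidean_space}) topology) backward_shift"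
proof -
  obtain e :: "nat \<Rightarrow> 'k" where e: "\<And>y \<epsilon>. 0 < \<epsilon> \<Longrightarrow> \<exists>i. dist (e i) y < \<epsilon>"
    using obtain_dense_sequence by blast
  \<comment> \<open>A list is used as a target only once \<open>p\<close> is large enough for its length and its entries.\<close>
  define small where "small = (\<lambda>p xs. length xs \<le> p \<and> (\<forall>a\<in>set xs. norm (e a) \<le> 2 ^ p))"
  \<comment> \<open>Decoding \<open>p\<close> as a pair makes every finite sequence a target for infinitely many \<open>p\<close>.\<close>
  define target where "target = (\<lambda>p. from_nat (fst (prod_decode p)) :: nat list)"
  define z where "z = (\<lambda>p. if small p (target p) then finite_sequence e (target p) else (\<lambda>_. 0))"
  have support: "z p i = 0" if "p \<le> i" for p i
    using that by (auto simp: z_def small_def finite_sequence_def)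
  have bound: "norm (z p i) \<le> 2 ^ p" for p i
    by (auto simp: z_def small_def finite_sequence_def)
  obtain x where x: "x \<in> c0_space weight" and approx: "\<And>p m. m \<in> hitting_times p \<Longrightarrow>
      c0_dist weight ((backward_shift ^^ m) x) (z p) \<le> (1 / 2) ^ p"
    using concatenation_approximates[of z, OF support bound] by metis
  have shift_x: "(backward_shift ^^ m) x \<in> c0_space weight" for m
    by (induction m) (auto simp: x weight.shift_in_c0)
  have "0 < lower_density (\<lambda>k. 1) (return_times backward_shift x U)"
    if U: "openin (c0_topology weight) U" "U \<noteq> {}" for U
  proof -
    obtain y where "y \<in> U" using U(2) by blast
    have "openin weight.c0.mtopology U" using U(1) by (simp only: weight.c0_topology)
    then obtain r where r: "0 < r" "weight.c0.mball y r \<subseteq> U" and "U \<subseteq> c0_space weight"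
      using \<open>y \<in> U\<close> unfolding weight.c0.openin_mtopology by blast
    then have y: "y \<in> c0_space weight" using \<open>y \<in> U\<close> by blast
    obtain xs where xs: "c0_dist weight y (finite_sequence e xs) < r / 2"
      using weight.finite_sequences_dense[OF e y half_gt_zero[OF r(1)]] by blast
    obtain k where k: "(\<Sum>a\<in>set xs. norm (e a)) < 2 ^ k" using real_arch_pow[of 2] by auto
    obtain l where l: "(1 / 2) ^ l < r / 2" using real_arch_pow_inv[of "r / 2" "1 / 2"] r(1) by auto
    define p where "p = prod_encode (to_nat xs, max (length xs) (max k l))"
    have p: "length xs \<le> p" "k \<le> p" "l \<le> p"
      using le_prod_encode_2[of "max (length xs) (max k l)" "to_nat xs"] by (auto simp: p_def)
    have "norm (e a) \<le> 2 ^ p" if "a \<in> set xs" for a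
    proof -
      have "norm (e a) \<le> (\<Sum>a\<in>set xs. norm (e a))" using that by (intro member_le_sum) auto
      also have "\<dots> \<le> 2 ^ k" using k by simp
      also have "\<dots> \<le> 2 ^ p" using p(2) by (intro power_increasing) auto
      finally show ?thesis .
    qed
    then have z: "z p = finite_sequence e xs"
      using p(1) by (simp add: z_def small_def target_def p_def)
    have "(1 / 2) ^ p < r / 2"
      by (rule le_less_trans[OF power_decreasing[OF p(3)] l]) auto
    have "hitting_times p \<subseteq> return_times backward_shift x U"
    proof
      fix m assume m: "m \<in> hitting_times p"
      have "c0_dist weight y ((backward_shift ^^ m) x)
          \<le> c0_dist weight y (z p) + c0_dist weight (z p) ((backward_shift ^^ m) x)"
        by (rule weight.c0_dist_triangle)
      also have "\<dots> < r"
        using xs z approx[OF m] \<open>(1 / 2) ^ p < r / 2\<close>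
          weight.c0.commute[of "z p" "(backward_shift ^^ m) x"] by simp
      finally have "(backward_shift ^^ m) x \<in> U" using r(2) y shift_x by auto
      moreover have "1 \<le> m"
        using m one_le_power[of "16::nat"] unfolding hitting_times_def by (auto intro: order_trans)
      ultimately show "m \<in> return_times backward_shift x U" by (simp add: return_times_def)
    qed
    then have "lower_density (\<lambda>k. 1) (hitting_times p)
        \<le> lower_density (\<lambda>k. 1) (return_times backward_shift x U)"
      by (rule lower_density_mono) simp
    then show ?thesis using lower_density_hitting_times[of p] by (rule less_le_trans[rotated])
  qed
  then show ?thesis
    unfolding frequently_hypercyclic_def weighted_frequently_hypercyclic_def weight.topspace_c0
    using x by blast
qed

section \<open>Vanishing lower density for the exponential weights\<close>

lemma mono_exp_weight: "0 < r \<Longrightarrow> i \<le> j \<Longrightarrow> exp_weight r i \<le> exp_weight r j"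
  by (simp add: exp_weight_def powr_mono2)

text \<open>The \<open>2 * M\<close> terms on the left are compared with the \<open>M\<close> terms of index between \<open>3 * M\<close> and \<open>4 * M\<close>.\<close>

lemma exp_weight_initial_sum:
  assumes "0 < r" "0 < M" "4 * M \<le> n"
  shows "(\<Sum>i=1..2 * M. exp_weight r i)
    \<le> 2 * exp (- (3 powr r - 2 powr r) * real M powr r) * (\<Sum>i=1..n. exp_weight r i)"
proof -
  have "(\<Sum>i=1..2 * M. exp_weight r i) \<le> of_nat (card {1..2 * M}) * exp_weight r (2 * M)"
    by (intro sum_bounded_above mono_exp_weight assms) auto
  also have "\<dots> = 2 * (exp_weight r (2 * M) / exp_weight r (3 * M)) * (M * exp_weight r (3 * M))"
    by (simp add: exp_weight_def)
  also have "exp_weight r (2 * M) / exp_weight r (3 * M) = exp (- (3 powr r - 2 powr r) * real M powr r)"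
    by (simp add: exp_weight_def powr_mult algebra_simps flip: exp_diff)
  also have "M * exp_weight r (3 * M) \<le> (\<Sum>i\<in>{3 * M<..4 * M}. exp_weight r i)"
  proof -
    have "of_nat (card {3 * M<..4 * M}) * exp_weight r (3 * M) \<le> (\<Sum>i\<in>{3 * M<..4 * M}. exp_weight r i)"
      by (intro sum_bounded_below mono_exp_weight assms) auto
    then show ?thesis by simp
  qed
  also have "(\<Sum>i\<in>{3 * M<..4 * M}. exp_weight r i) \<le> (\<Sum>i=1..n. exp_weight r i)"
    using assms(3) by (intro sum_mono2) (auto simp: exp_weight_def)
  finally show ?thesis by simp
qed

text \<open>If high level is forced on \<open>E\<close> beyond \<open>N\<close>, then \<open>E\<close> is covered up to the landmark by
  \<open>{1..N}\<close> and collars: the bands that begin before the landmark end at or before \<open>N\<close>.\<close>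

lemma landmark_cover:
  assumes E: "\<And>e. e \<in> E \<Longrightarrow> N < e \<Longrightarrow> p \<le> level e" and p: "1 \<le> p" and N: "3 * 16 ^ k \<le> N"
  shows "{1..landmark (Suc k)} \<inter> E
    \<subseteq> {1..N} \<union> (\<Union>q\<in>{p..k}. {1..landmark (Suc k)} \<inter> collar q)"
proof
  fix e assume e: "e \<in> {1..landmark (Suc k)} \<inter> E"
  show "e \<in> {1..N} \<union> (\<Union>q\<in>{p..k}. {1..landmark (Suc k)} \<inter> collar q)"
  proof (cases "e \<le> N")
    case False
    define q where "q = level e"
    have q: "p \<le> q" using E[of e] e False by (simp add: q_def)
    have "e \<notin> scale_band q"
    proof
      assume "e \<in> scale_band q"
      then have band: "16 ^ q \<le> 2 * e" "e \<le> 3 * 16 ^ q" by (auto simp: scale_band_def)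
      have "e \<le> landmark (Suc k)" using e by simp
      then have "16 ^ q < (16 ^ Suc k :: nat)" using band(1) landmark_eq[of "Suc k"] by linarith
      then have "q \<le> k" using power_less_imp_less_exp[of "16::nat" q "Suc k"] by simp
      then have "(16::nat) ^ q \<le> 16 ^ k" by (intro power_increasing) auto
      then show False using band(2) False N by linarith
    qed
    then have "e \<in> collar q" using level_cases[of e] q p by (simp add: q_def)
    moreover obtain j where j: "1 \<le> j" "j * 16 ^ q \<le> e + 2 * q"
      using \<open>e \<in> collar q\<close> by (auto simp: collar_def)
    have "q < Suc k" by (rule collar_below_landmark(1)) (use j q p e in auto)
    ultimately show ?thesis using e q by auto
  qed (use e in auto)
qed

lemma sum_UN_le:
  fixes f :: "'b \<Rightarrow> 'c::ordered_ab_group_add"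
  assumes "finite I" "\<And>i. i \<in> I \<Longrightarrow> finite (A i)" "\<And>x. 0 \<le> f x"
  shows "sum f (\<Union>i\<in>I. A i) \<le> (\<Sum>i\<in>I. sum f (A i))"
  using assms(1,2)
proof (induction I)
  case (insert i I)
  have "sum f (\<Union>i\<in>insert i I. A i)
      = sum f (A i) + sum f (\<Union>i\<in>I. A i) - sum f (A i \<inter> (\<Union>i\<in>I. A i))"
    using insert by (simp add: sum_Un)
  also have "\<dots> \<le> sum f (A i) + sum f (\<Union>i\<in>I. A i)"
    using sum_nonneg[of "A i \<inter> (\<Union>i\<in>I. A i)" f] assms(3) by simp
  also have "\<dots> \<le> sum f (A i) + (\<Sum>i\<in>I. sum f (A i))" using insert by simp
  finally show ?case using insert by simp
qed simp

lemma lower_density_exp_weight_not_positive: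
  assumes r: "0 < r" and level: "\<And>p. \<exists>K. \<forall>e\<in>E. K < e \<longrightarrow> p \<le> level e"
  shows "\<not> 0 < lower_density (exp_weight r) E"
proof
  assume "0 < lower_density (exp_weight r) E"
  then obtain c where c: "0 < ereal c" "ereal c < lower_density (exp_weight r) E"
    using ereal_dense2 by blast
  define s where "s = (\<lambda>n. \<Sum>i=1..n. exp_weight r i)"
  have ratio: "\<forall>\<^sub>F n in sequentially. ereal c < ereal ((\<Sum>k\<in>{1..n} \<inter> E. exp_weight r k) / s n)"
    using less_LiminfD[OF c(2)[unfolded lower_density_def]] by (simp add: s_def)
  obtain p0 where p0: "(1 / 2) ^ p0 < c / 4" using real_arch_pow_inv[of "c / 4" "1 / 2"] c(1) by auto
  define p where "p = max 2 p0"
  have p: "2 \<le> p" "p0 \<le> p" by (auto simp: p_def)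
  have pc: "(1 / 2) ^ p < c / 4"
    by (rule le_less_trans[OF power_decreasing[OF p(2)] p0]) auto
  have geometric: "(\<Sum>q=p..m. (1 / 2) ^ q) \<le> 2 * (1 / 2 :: real) ^ p" for m
    by (simp add: sum_gp)
  obtain K where K: "\<And>e. e \<in> E \<Longrightarrow> K < e \<Longrightarrow> p \<le> level e" using level by blast
  \<comment> \<open>Here \<open>2 * M k = 3 * 16 ^ (k + 1)\<close> is the right end of the last band before the landmark \<open>n k\<close>.\<close>
  define M where "M = (\<lambda>k. 24 * 16 ^ k :: nat)"
  define n where "n = (\<lambda>k. landmark (Suc (Suc k)))"
  have n: "4 * M k \<le> n k" for k
    using landmark_eq[of "Suc (Suc k)"] one_le_power[of "16::nat" k] unfolding n_def M_def power_Suc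
    by linarith
  have k_le: "k \<le> M k" for k using linear_less_power_16[of k] by (simp add: M_def)
  have pos: "0 < s (n k)" for k
  proof -
    have "1 \<le> n k" using n[of k] one_le_power[of "16::nat" k] unfolding M_def by linarith
    then show ?thesis unfolding s_def by (intro sum_pos) (auto simp: exp_weight_def)
  qed
  define \<theta> where "\<theta> = (\<lambda>m. 2 * exp (- (3 powr r - 2 powr r) * real m powr r))"
  have "(2::real) powr r < 3 powr r" using r by (intro powr_less_mono2) auto
  then have "\<theta> \<longlonglongrightarrow> 0" unfolding \<theta>_def using r by real_asymp
  moreover have M_top: "filterlim M at_top sequentially"
    by (rule filterlim_at_top_mono[OF filterlim_ident]) (simp add: k_le)
  ultimately have "(\<lambda>k. \<theta> (M k)) \<longlonglongrightarrow> 0" by (rule filterlim_compose)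
  then have "\<forall>\<^sub>F k in sequentially. \<theta> (M k) < c / 2"
    using c(1) by (intro order_tendstoD(2)) auto
  moreover have "\<forall>\<^sub>F k in sequentially. ereal c < ereal ((\<Sum>i\<in>{1..n k} \<inter> E. exp_weight r i) / s (n k))"
  proof (rule eventually_compose_filterlim[OF ratio])
    have "k \<le> n k" for k using k_le[of k] n[of k] by linarith
    then show "filterlim n at_top sequentially"
      by (intro filterlim_at_top_mono[OF filterlim_ident]) simp
  qed
  ultimately have "\<forall>\<^sub>F k in sequentially. False"
    using eventually_ge_at_top[of K]
  proof eventually_elim
    case (elim k)
    have cover: "{1..n k} \<inter> E \<subseteq> {1..2 * M k} \<union> (\<Union>q\<in>{p..Suc k}. {1..n k} \<inter> collar q)"
      unfolding n_def
    proof (rule landmark_cover)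
      show "p \<le> level e" if "e \<in> E" "2 * M k < e" for e
        using K[of e] that elim(3) k_le[of k] by linarith
    qed (use p in \<open>auto simp: M_def\<close>)
    have "(\<Sum>i\<in>{1..n k} \<inter> E. exp_weight r i)
        \<le> (\<Sum>i\<in>{1..2 * M k} \<union> (\<Union>q\<in>{p..Suc k}. {1..n k} \<inter> collar q). exp_weight r i)"
      using cover by (intro sum_mono2) (auto simp: exp_weight_def)
    also have "\<dots> \<le> s (2 * M k) + (\<Sum>i\<in>(\<Union>q\<in>{p..Suc k}. {1..n k} \<inter> collar q). exp_weight r i)"
      unfolding s_def by (subst sum_Un) (auto simp: exp_weight_def intro: sum_nonneg)
    also have "(\<Sum>i\<in>(\<Union>q\<in>{p..Suc k}. {1..n k} \<inter> collar q). exp_weight r i)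
        \<le> (\<Sum>q\<in>{p..Suc k}. \<Sum>i\<in>{1..n k} \<inter> collar q. exp_weight r i)"
      by (rule sum_UN_le) (auto simp: exp_weight_def)
    also have "\<dots> \<le> (\<Sum>q\<in>{p..Suc k}. s (n k) * (1 / 2) ^ q)"
    proof (rule sum_mono)
      fix q assume "q \<in> {p..Suc k}"
      then have "2 \<le> q" using p by simp
      then show "(\<Sum>i\<in>{1..n k} \<inter> collar q. exp_weight r i) \<le> s (n k) * (1 / 2) ^ q"
        using collar_weight_le[of q "exp_weight r" "Suc (Suc k)"] mono_exp_weight[OF r]
        by (simp add: n_def s_def power_divide exp_weight_def)
    qed
    also have "\<dots> = s (n k) * (\<Sum>q\<in>{p..Suc k}. (1 / 2) ^ q)" by (simp only: sum_distrib_left)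
    also have "(\<Sum>q\<in>{p..Suc k}. (1 / 2) ^ q) \<le> 2 * (1 / 2 :: real) ^ p"
      by (rule geometric)
    also have "s (2 * M k) \<le> \<theta> (M k) * s (n k)"
      unfolding s_def \<theta>_def by (rule exp_weight_initial_sum[OF r _ n]) (simp add: M_def)
    finally have "(\<Sum>i\<in>{1..n k} \<inter> E. exp_weight r i) \<le> (\<theta> (M k) + 2 * (1 / 2) ^ p) * s (n k)"
      using pos[of k] by (simp add: algebra_simps)
    also have "\<dots> \<le> c * s (n k)"
      using elim(1) pc pos[of k] by (intro mult_right_mono) auto
    finally show False using elim(2) pos[of k] by (simp add: field_simps)
  qed
  then show False by simp
qed

lemma not_weighted_frequently_hypercyclic_shift:
  assumes "0 < r"
  shows "\<not> weighted_frequently_hypercyclic (exp_weight r)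
    (c0_topology weight :: (nat \<Rightarrow> 'k::{real_normed_field, euclidean_space}) topology) backward_shift"
proof
  define y :: "nat \<Rightarrow> 'k" where "y = (\<lambda>n. if n = 0 then 2 else 0)"
  have y: "y \<in> c0_space weight" by (rule weight.finite_support_in_c0[of 1]) (simp add: y_def)
  define U where "U = weight.c0.mball y 1"
  assume "weighted_frequently_hypercyclic (exp_weight r) (c0_topology weight)
    (backward_shift :: (nat \<Rightarrow> 'k) \<Rightarrow> _)"
  then obtain x where x: "x \<in> c0_space weight"
    and pos: "\<And>U. openin (c0_topology weight) U \<Longrightarrow> U \<noteq> {} \<Longrightarrow>
      0 < lower_density (exp_weight r) (return_times backward_shift (x :: nat \<Rightarrow> 'k) U)"
    unfolding weighted_frequently_hypercyclic_def weight.topspace_c0 by blast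
  have "\<exists>K. \<forall>n\<in>return_times backward_shift x U. K < n \<longrightarrow> p \<le> level n" for p
  proof -
    obtain K where K: "\<forall>n\<ge>K. weight n * norm (x n) < (1 / 2) ^ (2 * p)"
      using weight.c0_spaceD[OF x, of "(1 / 2) ^ (2 * p)"] by auto
    have "p \<le> level n" if n: "n \<in> return_times backward_shift x U" "K < n" for n
    proof -
      have "c0_dist weight y ((backward_shift ^^ n) x) < 1"
        using n(1) by (simp add: return_times_def U_def)
      from weight.c0_dist_less_imp[OF this, of 0]
      have "norm (2 - x n) < 1"
        by (simp add: y_def backward_shift_funpow weight_def height_def)
      then have "1 \<le> norm (x n)" using norm_triangle_ineq2[of 2 "x n"] by simp
      then have "weight n \<le> weight n * norm (x n)"
        using weight.weight_pos[of n] by simp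
      also have "\<dots> < (1 / 2) ^ (2 * p)" using K n(2) by simp
      finally have "\<not> height n \<le> 2 * p"
        using power_decreasing[of "height n" "2 * p" "1 / 2 :: real"] by (auto simp: weight_def)
      then show ?thesis using height_le[of n] by linarith
    qed
    then show ?thesis by blast
  qed
  then have "\<not> 0 < lower_density (exp_weight r) (return_times backward_shift x U)"
    by (rule lower_density_exp_weight_not_positive[OF assms])
  moreover have "y \<in> U" using y by (simp add: U_def)
  then have "U \<noteq> {}" by blast
  ultimately show False using pos[of U] by (simp add: U_def)
qed

lemma not_frequent_hypercyclicity_criterion_shift:
  "\<not> frequent_hypercyclicity_criterion
    (c0_topology weight :: (nat \<Rightarrow> 'k::{real_normed_field, euclidean_space}) topology) backward_shift"
proof
  assume "frequent_hypercyclicity_criterion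
    (c0_topology weight :: (nat \<Rightarrow> 'k) topology) backward_shift"
  then have "weight \<longlonglongrightarrow> 0" by (rule weight.criterion_imp_weight_tendsto_0)
  moreover have "filterlim landmark at_top sequentially"
  proof (rule filterlim_at_top_mono[OF filterlim_ident])
    have "k \<le> landmark k" for k
    proof -
      have "5 * k + 2 \<le> 2 * 16 ^ k" by (induction k) auto
      then show ?thesis using landmark_eq[of k] by linarith
    qed
    then show "\<forall>\<^sub>F k in sequentially. k \<le> landmark k" by simp
  qed
  ultimately have "(\<lambda>k. weight (landmark k)) \<longlonglongrightarrow> 0" by (rule filterlim_compose)
  then show False by (simp add: weight_def height_landmark LIMSEQ_const_iff)
qed

theorem theorem5p4:
  shows "\<exists>(X :: (nat \<Rightarrow> 'k::{real_normed_field, euclidean_space}) topology) T.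
    frechet_space seq_scale X \<and> separable_space X \<and>
    continuous_linear_operator seq_scale X T \<and>
    frequently_hypercyclic X T \<and>
    (\<forall>r::real. 0 < r \<and> r \<le> 1 \<longrightarrow> \<not> weighted_frequently_hypercyclic (exp_weight r) X T) \<and>
    \<not> frequent_hypercyclicity_criterion X T"
  by (intro exI[of _ "c0_topology weight"] exI[of _ backward_shift] conjI allI impI
      weight.frechet_space_c0 weight.separable_space_c0 weight.backward_shift_continuous_linear
      frequently_hypercyclic_shift not_weighted_frequently_hypercyclic_shift
      not_frequent_hypercyclicity_criterion_shift) simp

end
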